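(* Fix integers $n,L,M,K\ge 1$, a power $P>0$, and a (deterministic, unknown to the receiver) number $K_a\in[0:K]$ of active users. For a parameter $0<P'\le P$, consider the following scheme. A random codebook $\mathbf C=[\mathbf c_1,\dots,\mathbf c_M]\in\mathbb C^{n\times M}$ is drawn either (G) with columns i.i.d. $\mathcal{CN}(\mathbf 0,P'\mathbf I_n)$, or (S) with columns drawn i.i.d. uniformly from the sphere of radius $\sqrt{nP'}=\sqrt{nP}$ in $\mathbb C^n$ (so $P'=P$ in case (S)). Each active user $k$ picks its message $W_k$ uniformly from $[M]$, independently, and transmits $\mathbf x_{W_k}=\mathbf c_{W_k}\,1\{\|\mathbf c_{W_k}\|_2^2\le nP\}$. The receiver, with $L$ antennas, observes $\mathbf Y=[\mathbf y_1,\dots,\mathbf y_L]$, $\mathbf y_l=\sum_{k\in\mathcal K_a}h_{k,l}\mathbf x_{W_k}+\mathbf z_l$, where $h_{k,l}$ are i.i.d. $\mathcal{CN}(0,1)$ and $\mathbf z_l$ are i.i.d. $\mathcal{CN}(\mathbf 0,\mathbf I_n)$, all independent and unknown to the receiver. The receiver estimates the number of active users as $$K'_a\in\arg\min_{\tilde K_a\in[0:K]}\Big|\|\mathbf Y\|_F^2-nL(1+\tilde K_aP')\Big|.$$ Then for every $K'_a\ne K_a$, the probability $\mathbb P[K_a\to K'_a]$ that $K_a$ is estimated as $K'_a$ satisfies $$\mathbb P[K_a\to K'_a]\le \min_{0<P'\le P}\big\{p_{K_a\to K'_a,\mathrm{new}}+p_{0,K_a}\big\},$$ (where the left-hand side refers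 to the scheme with the minimizing parameter $P'$), with $$p_{K_a\to K'_a,\mathrm{new}}=\min_{\tilde K_a\in[0:K],\ \tilde K_a\ne K'_a}\Big\{1[K'_a<\tilde K_a]\,p_{K'_a,1}+1[K'_a>\tilde K_a]\,p_{K'_a,2}\Big\},$$ $$p_{K'_a,1}=\mathbb E\Big[\min_{\rho\ge0}\exp\Big\{\rho nL(1+\tilde K'_aP')-L\ln|\mathbf I_n+\rho\mathbf F|\Big\}\Big],$$ $$p_{K'_a,2}=\mathbb E\Big[\min_{0\le\rho<1/(1+\lambda'_1)}\exp\Big\{-\rho nL(1+\tilde K'_aP')-L\ln|\mathbf I_n-\rho\mathbf F|\Big\}\Big],$$ where $\tilde K'_a=(K'_a+\tilde K_a)/2$, $\mathbf F=\mathbf I_n+\mathbf C\boldsymbol\Lambda_{\mathcal K_a}\mathbf C^H$, $\lambda'_1$ is the largest eigenvalue of $\mathbf C\boldsymbol\Lambda_{\mathcal K_a}\mathbf C^H$, and $p_{0,K_a}=K_a\Gamma(n,nP/P')/\Gamma(n)$ in case (G) and $p_{0,K_a}=0$ in case (S).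
   Context: $[k_1:k_2]=\{k_1,\dots,k_2\}$, $[k]=\{1,\dots,k\}$. $\mathcal K_a$ is the set of active users, $|\mathcal K_a|=K_a$. $\boldsymbol\Lambda_{\mathcal K_a}\in\mathbb N^{M\times M}$ is the diagonal matrix whose $(m,m)$ entry is the number of active users that selected message $m$. Expectations are over the random codebook $\mathbf C$ and the messages of the active users. $\Gamma(a,x)=\int_x^\infty t^{a-1}e^{-t}dt$ is the upper incomplete gamma function and $\Gamma(\cdot)$ the gamma function. $|\cdot|$ denotes determinant and $\|\cdot\|_F$ the Frobenius norm. *)

theory Defs
  imports "HOL-Probability.Probability" "Jordan_Normal_Form.Char_Poly" "Jordan_Normal_Form.Determinant"
begin

definition cgauss :: "real \<Rightarrow> complex measure" where
  "cgauss v = distr (density lborel (normal_density 0 (sqrt (v/2)))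
                      \<Otimes>\<^sub>M density lborel (normal_density 0 (sqrt (v/2))))
                 borel (\<lambda>(a,b). Complex a b)"

(* vectors in C^n are functions on {..<n};  squared Euclidean norm *)
definition vsqnorm :: "nat \<Rightarrow> (nat \<Rightarrow> complex) \<Rightarrow> real" where
  "vsqnorm n x = (\<Sum>i<n. (cmod (x i))\<^sup>2)"

abbreviation lebC :: "nat \<Rightarrow> (nat \<Rightarrow> complex) measure" where
  "lebC n \<equiv> PiM {..<n} (\<lambda>_. lborel)"

(* Uniform distribution on the sphere of radius r in C^n: the normalized (cone = surface)
   measure, i.e. radial projection of the uniform distribution on the unit ball. *)
definition sphere_unif :: "nat \<Rightarrow> real \<Rightarrow> (nat \<Rightarrow> complex) measure" where
  "sphere_unif n r =
     distr (uniform_measure (lebC n) {x \<in> space (lebC n). vsqnorm n x \<le> 1})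
           (PiM {..<n} (\<lambda>_. borel))
           (\<lambda>x. restrict (\<lambda>i. complex_of_real (r / sqrt (vsqnorm n x)) * x i) {..<n})"

definition col_dist :: "bool \<Rightarrow> nat \<Rightarrow> real \<Rightarrow> real \<Rightarrow> (nat \<Rightarrow> complex) measure" where
  "col_dist sph n P P' = (if sph then sphere_unif n (sqrt (real n * P))
                          else PiM {..<n} (\<lambda>_. cgauss P'))"

(* codebook: cb m = column m (m < M), cb m i = entry i (i < n) *)
definition codebook_measure :: "bool \<Rightarrow> nat \<Rightarrow> nat \<Rightarrow> real \<Rightarrow> real \<Rightarrow> (nat \<Rightarrow> nat \<Rightarrow> complex) measure" where
  "codebook_measure sph n M P P' = PiM {..<M} (\<lambda>_. col_dist sph n P P')"

definition msg_measure :: "nat \<Rightarrow> nat \<Rightarrow> (nat \<Rightarrow> nat) measure" where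
  "msg_measure Ka M = PiM {..<Ka} (\<lambda>_. measure_pmf (pmf_of_set {..<M}))"

definition fading_measure :: "nat \<Rightarrow> nat \<Rightarrow> (nat \<Rightarrow> nat \<Rightarrow> complex) measure" where
  "fading_measure Ka L = PiM {..<Ka} (\<lambda>_. PiM {..<L} (\<lambda>_. cgauss 1))"

definition noise_measure :: "nat \<Rightarrow> nat \<Rightarrow> (nat \<Rightarrow> nat \<Rightarrow> complex) measure" where
  "noise_measure n L = PiM {..<L} (\<lambda>_. PiM {..<n} (\<lambda>_. cgauss 1))"

definition scheme_space where
  "scheme_space sph n L M P P' Ka =
     codebook_measure sph n M P P' \<Otimes>\<^sub>M msg_measure Ka M \<Otimes>\<^sub>M
     fading_measure Ka L \<Otimes>\<^sub>M noise_measure n L"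

definition xmit :: "nat \<Rightarrow> real \<Rightarrow> (nat \<Rightarrow> nat \<Rightarrow> complex) \<Rightarrow> nat \<Rightarrow> nat \<Rightarrow> complex" where
  "xmit n P cb m i = (if vsqnorm n (cb m) \<le> real n * P then cb m i else 0)"

definition rx :: "nat \<Rightarrow> real \<Rightarrow> nat \<Rightarrow> (nat \<Rightarrow> nat \<Rightarrow> complex) \<Rightarrow> (nat \<Rightarrow> nat)
                   \<Rightarrow> (nat \<Rightarrow> nat \<Rightarrow> complex) \<Rightarrow> (nat \<Rightarrow> nat \<Rightarrow> complex) \<Rightarrow> nat \<Rightarrow> nat \<Rightarrow> complex" where
  "rx n P Ka cb w h z l i = (\<Sum>k<Ka. h k l * xmit n P cb (w k) i) + z l i"

definition frob2 :: "nat \<Rightarrow> nat \<Rightarrow> (nat \<Rightarrow> nat \<Rightarrow> complex) \<Rightarrow> real" where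
  "frob2 n L Y = (\<Sum>l<L. \<Sum>i<n. (cmod (Y l i))\<^sup>2)"

definition is_est :: "nat \<Rightarrow> nat \<Rightarrow> nat \<Rightarrow> real \<Rightarrow> real \<Rightarrow> nat \<Rightarrow> bool" where
  "is_est n L K P' y Kest \<longleftrightarrow> Kest \<le> K \<and>
     (\<forall>Kt\<le>K. \<bar>y - real n * real L * (1 + real Kest * P')\<bar>
               \<le> \<bar>y - real n * real L * (1 + real Kt * P')\<bar>)"

definition est_event where
  "est_event sph n L M K P P' Ka Kest =
     {(cb, w, h, z) \<in> space (scheme_space sph n L M P P' Ka).
        is_est n L K P' (frob2 n L (rx n P Ka cb w h z)) Kest}"

(* C Lambda_{K_a} C^H, with Lambda(m,m) = number of active users choosing m *)
definition gram :: "nat \<Rightarrow> nat \<Rightarrow> nat \<Rightarrow> (nat \<Rightarrow> nat \<Rightarrow> complex) \<Rightarrow> (nat \<Rightarrow> nat) \<Rightarrow> complex mat" where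
  "gram n M Ka cb w = mat n n (\<lambda>(i,j).
      \<Sum>m<M. of_nat (card {k. k < Ka \<and> w k = m}) * cb m i * cnj (cb m j))"

definition Fmat where "Fmat n M Ka cb w = 1\<^sub>m n + gram n M Ka cb w"

(* largest eigenvalue lambda'_1 of C Lambda C^H (Hermitian, so its eigenvalues are real) *)
definition lam1 where
  "lam1 n M Ka cb w = Max {e::real. eigenvalue (gram n M Ka cb w) (complex_of_real e)}"

definition p1_integrand where
  "p1_integrand n L M Ka P' Kth cb w =
     (INF \<rho>\<in>{0::real..}. exp (\<rho> * real n * real L * (1 + Kth * P')
        - real L * ln (Re (det (1\<^sub>m n + complex_of_real \<rho> \<cdot>\<^sub>m Fmat n M Ka cb w)))))"

definition p2_integrand where
  "p2_integrand n L M Ka P' Kth cb w =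
     (INF \<rho>\<in>{0::real..<1 / (1 + lam1 n M Ka cb w)}. exp (- \<rho> * real n * real L * (1 + Kth * P')
        - real L * ln (Re (det (1\<^sub>m n - complex_of_real \<rho> \<cdot>\<^sub>m Fmat n M Ka cb w)))))"

definition p1 where
  "p1 sph n L M Ka P P' Kth =
     (\<integral>\<^sup>+ (cb, w). ennreal (p1_integrand n L M Ka P' Kth cb w)
        \<partial>(codebook_measure sph n M P P' \<Otimes>\<^sub>M msg_measure Ka M))"

definition p2 where
  "p2 sph n L M Ka P P' Kth =
     (\<integral>\<^sup>+ (cb, w). ennreal (p2_integrand n L M Ka P' Kth cb w)
        \<partial>(codebook_measure sph n M P P' \<Otimes>\<^sub>M msg_measure Ka M))"

definition p_new where
  "p_new sph n L M K Ka P P' Kest =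
     Min ((\<lambda>Kt. (if Kest < Kt then p1 sph n L M Ka P P' ((real Kest + real Kt) / 2) else 0)
              + (if Kest > Kt then p2 sph n L M Ka P P' ((real Kest + real Kt) / 2) else 0))
          ` ({0..K} - {Kest}))"

definition upper_gamma :: "real \<Rightarrow> real \<Rightarrow> real" where
  "upper_gamma a x = (LINT t:{x..}|lborel. t powr (a - 1) * exp (- t))"

definition p0 where
  "p0 sph n Ka P P' = (if sph then 0
      else real Ka * upper_gamma (real n) (real n * P / P') / Gamma (real n))"

end

theory Submission
  imports Defs
begin

text \<open>
  Estimating \<open>K'\<close> forces \<open>\<parallel>Y\<parallel>\<^sup>2\<close> to lie on the \<open>K'\<close>-side of the midpoint
  \<open>nL(1 + (K' + K~)P'/2)\<close> for every competitor \<open>K~\<close>. Unless some active codeword violates the power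
  constraint (a union bound, with the tail of an Erlang variable, gives \<open>p0\<close>), the channel output given
  codebook and messages is \<open>L\<close> independent complex Gaussian vectors with covariance \<open>F\<close>, so the Chernoff
  bound applies with moment generating function \<open>det (1 - s F)\<^sup>-\<^sup>L\<close>.

  That generating function is obtained by integrating the noise, which leaves a Gaussian integral
  over the fading coefficients with quadratic form \<open>1 - t X\<^sup>H X\<close>, \<open>t = s / (1 - s)\<close>. It is evaluated one
  user at a time by completing the square, each step replacing the form by a Schur complement;
  \<open>det (1 - t X\<^sup>H X) = det (1 - t X X\<^sup>H)\<close> returns to \<open>F\<close>. Positive definiteness for
  \<open>s < 1 / (1 + lam1)\<close> holds because the maximum of the Rayleigh quotient is an eigenvalue.
\<close>

section \<open>Products of probability measures\<close>

lemma measurable_PiM_PiM_component [measurable (raw)]: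
  assumes "i \<in> I" "j \<in> J"
  shows "(\<lambda>h. h i j) \<in> measurable (PiM I (\<lambda>i. PiM J (N i))) (N i j)"
  using measurable_compose[OF measurable_component_singleton[OF assms(1)]
      measurable_component_singleton[OF assms(2)]] .

lemma nn_integral_PiM_columns:
  fixes M :: "'a measure" and f :: "'j \<Rightarrow> ('i \<Rightarrow> 'a) \<Rightarrow> ennreal"
  assumes "prob_space M" "finite I" "finite J"
    and "\<And>j. j \<in> J \<Longrightarrow> f j \<in> borel_measurable (PiM I (\<lambda>_. M))"
  shows "(\<integral>\<^sup>+h. (\<Prod>j\<in>J. f j (\<lambda>i\<in>I. h i j)) \<partial>PiM I (\<lambda>_. PiM J (\<lambda>_. M))) =
    (\<Prod>j\<in>J. \<integral>\<^sup>+g. f j g \<partial>PiM I (\<lambda>_. M))"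
  using \<open>finite I\<close> assms(4)
proof (induction I arbitrary: f rule: finite_induct)
  case empty
  show ?case
    by (simp add: PiM_empty nn_integral_count_space_finite)
next
  case (insert i I)
  let ?G = "PiM J (\<lambda>_. M)"
  interpret M: product_prob_space "\<lambda>_. M" I
    by (intro product_prob_spaceI assms)
  interpret M': product_prob_space "\<lambda>_. M" J
    by (intro product_prob_spaceI assms)
  interpret G: product_prob_space "\<lambda>_. ?G" I
    by (intro product_prob_spaceI prob_space_PiM assms)
  have [measurable]: "f j \<in> borel_measurable (PiM (insert i I) (\<lambda>_. M))" if "j \<in> J" for j
    using insert.prems that by blast
  have restrict_upd: "(\<lambda>k\<in>insert i I. (h(i := y)) k j) = (\<lambda>k\<in>I. h k j)(i := y j)" for h y j
    using insert.hyps by auto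
  have "(\<integral>\<^sup>+h. (\<Prod>j\<in>J. f j (\<lambda>k\<in>insert i I. h k j)) \<partial>PiM (insert i I) (\<lambda>_. ?G)) =
      (\<integral>\<^sup>+h. \<integral>\<^sup>+y. (\<Prod>j\<in>J. f j ((\<lambda>k\<in>I. h k j)(i := y j))) \<partial>?G \<partial>PiM I (\<lambda>_. ?G))"
    unfolding restrict_upd[symmetric] using insert.hyps
    by (intro G.product_nn_integral_insert) measurable
  also have "\<dots> = (\<integral>\<^sup>+h. (\<Prod>j\<in>J. \<integral>\<^sup>+m. f j ((\<lambda>k\<in>I. h k j)(i := m)) \<partial>M) \<partial>PiM I (\<lambda>_. ?G))"
  proof (intro nn_integral_cong M'.product_nn_integral_prod)
    fix h j assume "h \<in> space (PiM I (\<lambda>_. ?G))" "j \<in> J"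
    then have "(\<lambda>k\<in>I. h k j) \<in> space (PiM I (\<lambda>_. M))"
      by (auto simp: space_PiM PiE_iff)
    then show "(\<lambda>m. f j ((\<lambda>k\<in>I. h k j)(i := m))) \<in> borel_measurable M"
      using \<open>j \<in> J\<close> by measurable
  qed (rule \<open>finite J\<close>)
  also have "\<dots> = (\<Prod>j\<in>J. \<integral>\<^sup>+g. (\<integral>\<^sup>+m. f j (g(i := m)) \<partial>M) \<partial>PiM I (\<lambda>_. M))"
    by (intro insert.IH) measurable
  also have "\<dots> = (\<Prod>j\<in>J. \<integral>\<^sup>+g. f j g \<partial>PiM (insert i I) (\<lambda>_. M))"
    using insert by (intro prod.cong refl M.product_nn_integral_insert[symmetric]) auto
  finally show ?case .
qed

section \<open>The circularly symmetric complex Gaussian distribution\<close>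

lemma sets_cgauss [simp, measurable_cong]: "sets (cgauss v) = sets borel"
  by (simp add: cgauss_def)

lemma space_cgauss [simp]: "space (cgauss v) = UNIV"
  by (simp add: cgauss_def)

lemma measurable_Complex [measurable]:
  "(\<lambda>(a,b). Complex a b) \<in> borel_measurable (borel \<Otimes>\<^sub>M borel)"
  unfolding Complex_eq by measurable

lemma distr_lborel_Complex:
  "distr (lborel \<Otimes>\<^sub>M lborel) borel (\<lambda>(a,b). Complex a b) = lborel"
proof (rule lborel_eqI[symmetric])
  fix l u :: complex
  assume lower_le_upper: "\<And>b. b \<in> Basis \<Longrightarrow> l \<bullet> b \<le> u \<bullet> b"
  have "Re l \<le> Re u" "Im l \<le> Im u"
    using lower_le_upper[of 1] lower_le_upper[of \<i>] by (simp_all add: Basis_complex_def)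
  moreover have "(\<lambda>(a,b). Complex a b) -` box l u = {Re l<..<Re u} \<times> {Im l<..<Im u}"
    by (auto simp: in_box_complex_iff)
  ultimately show "emeasure (distr (lborel \<Otimes>\<^sub>M lborel) borel (\<lambda>(a,b). Complex a b)) (box l u) =
      ennreal (\<Prod>b\<in>Basis. (u - l) \<bullet> b)"
    by (simp add: emeasure_distr space_pair_measure lborel.emeasure_pair_measure_Times
        ennreal_mult Basis_complex_def)
qed simp

lemma prob_space_cgauss:
  assumes "v > 0"
  shows "prob_space (cgauss v)"
proof -
  let ?D = "density lborel (normal_density 0 (sqrt (v/2)))"
  interpret D: prob_space ?D
    by (rule prob_space_normal_density) (use assms in simp)
  interpret DD: pair_prob_space ?D ?D ..
  show ?thesis
    unfolding cgauss_def by (rule DD.prob_space_distr) simp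
qed

lemma cgauss_eq_density:
  assumes "v > 0"
  shows "cgauss v = density lborel (\<lambda>z. ennreal (exp (- ((cmod z)\<^sup>2 / v)) / (pi * v)))"
proof -
  let ?g = "\<lambda>x. ennreal (normal_density 0 (sqrt (v/2)) x)"
  let ?f = "\<lambda>z. ennreal (exp (- ((cmod z)\<^sup>2 / v)) / (pi * v))"
  interpret D: prob_space "density lborel ?g"
    by (rule prob_space_normal_density) (use assms in simp)
  have "density lborel ?g \<Otimes>\<^sub>M density lborel ?g = density (lborel \<Otimes>\<^sub>M lborel) (\<lambda>(x,y). ?g x * ?g y)"
    by (intro pair_measure_density)
      (auto simp: D.sigma_finite_measure_axioms lborel.sigma_finite_measure_axioms)
  also have "(\<lambda>(x,y). ?g x * ?g y) = (\<lambda>p. ?f (case p of (a,b) \<Rightarrow> Complex a b))"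
    using assms
    by (auto simp: fun_eq_iff ennreal_mult'[symmetric] normal_density_def mult_exp_exp
        add_divide_distrib cmod_power2)
  finally have "cgauss v = distr (density (lborel \<Otimes>\<^sub>M lborel) (\<lambda>p. ?f (case p of (a,b) \<Rightarrow> Complex a b)))
      borel (\<lambda>(a,b). Complex a b)"
    by (simp add: cgauss_def)
  also have "\<dots> = density (distr (lborel \<Otimes>\<^sub>M lborel) borel (\<lambda>(a,b). Complex a b)) ?f"
    by (rule density_distr[symmetric]) measurable
  finally show ?thesis
    by (simp add: distr_lborel_Complex)
qed

lemma nn_integral_cgauss_exp_quadratic:
  assumes "v > 0" "a > 0"
  shows "(\<integral>\<^sup>+z. ennreal (exp ((cmod z)\<^sup>2 / v - a * (cmod (z + b))\<^sup>2)) \<partial>cgauss v) =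
    ennreal (1 / (a * v))"
proof -
  let ?g = "\<lambda>z. ennreal (exp (- ((cmod z)\<^sup>2 / (1 / a))) / (pi * (1 / a)))"
  have "(\<integral>\<^sup>+z. ennreal (exp ((cmod z)\<^sup>2 / v - a * (cmod (z + b))\<^sup>2)) \<partial>cgauss v) =
      (\<integral>\<^sup>+z. ennreal (1 / (a * v)) * ?g (b + z) \<partial>lborel)"
    unfolding cgauss_eq_density[OF assms(1)] using assms
    by (subst nn_integral_density)
      (auto simp: ennreal_mult'[symmetric] mult_exp_exp ac_simps intro!: nn_integral_cong)
  also have "\<dots> = ennreal (1 / (a * v)) * (\<integral>\<^sup>+z. ?g z \<partial>distr lborel borel ((+) b))"
    by (simp add: nn_integral_cmult nn_integral_distr)
  also have "(\<integral>\<^sup>+z. ?g z \<partial>distr lborel borel ((+) b)) = emeasure (cgauss (1 / a)) UNIV"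
    using assms by (simp add: lborel_distr_plus cgauss_eq_density emeasure_density)
  also have "\<dots> = 1"
    using prob_space.emeasure_space_1[OF prob_space_cgauss[of "1 / a"]] assms by simp
  finally show ?thesis
    by simp
qed

section \<open>Determinants of block matrices\<close>

abbreviation kernel_mat :: "nat \<Rightarrow> (nat \<Rightarrow> nat \<Rightarrow> 'a) \<Rightarrow> 'a mat" where
  "kernel_mat N B \<equiv> mat N N (\<lambda>(i,j). B i j)"

lemma det_four_block_mat_eliminate_lower_left:
  fixes A :: "'a :: idom mat"
  assumes "A \<in> carrier_mat n n" "B \<in> carrier_mat n m" "C \<in> carrier_mat m n" "D \<in> carrier_mat m m"
    and "E \<in> carrier_mat m n" "C + D * E = 0\<^sub>m m n"
  shows "det (four_block_mat A B C D) = det (A + B * E) * det D"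
proof -
  let ?L = "four_block_mat (1\<^sub>m n) (0\<^sub>m n m) E (1\<^sub>m m)"
  have "four_block_mat A B C D * ?L = four_block_mat (A * 1\<^sub>m n + B * E) (A * 0\<^sub>m n m + B * 1\<^sub>m m)
      (C * 1\<^sub>m n + D * E) (C * 0\<^sub>m n m + D * 1\<^sub>m m)"
    by (rule mult_four_block_mat) (use assms in auto)
  also have "\<dots> = four_block_mat (A + B * E) B (0\<^sub>m m n) D"
    using assms by simp
  also have "det \<dots> = det (A + B * E) * det D"
    using assms by (simp add: det_four_block_mat_lower_left_zero[of _ n _ m])
  also have "det (four_block_mat A B C D * ?L) = det (four_block_mat A B C D) * det ?L"
    by (rule det_mult[of _ "n + m"]) (use assms in auto)
  also have "det ?L = 1"
    using assms by (subst det_four_block_mat_upper_right_zero[of _ n _ m]) auto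
  finally show ?thesis by simp
qed

lemma det_one_minus_mult_commute:
  fixes B :: "'a :: idom mat"
  assumes carriers: "B \<in> carrier_mat n m" "C \<in> carrier_mat m n"
  shows "det (1\<^sub>m n - B * C) = det (1\<^sub>m m - C * B)"
proof -
  let ?M = "four_block_mat (1\<^sub>m n) B C (1\<^sub>m m)"
  let ?L = "four_block_mat (1\<^sub>m n) (0\<^sub>m n m) (- C) (1\<^sub>m m)"
  have products: "B * C \<in> carrier_mat n n" "C * B \<in> carrier_mat m m"
    using carriers by auto
  have "1\<^sub>m n - B * C = 1\<^sub>m n + B * (- C)"
    using carriers products by (intro eq_matI) auto
  then have "det (1\<^sub>m n - B * C) = det ?M"
    using carriers by (subst det_four_block_mat_eliminate_lower_left[where E = "- C"]) auto
  also have "\<dots> = det (?L * ?M)"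
    using carriers
    by (subst det_mult[of _ "n + m"]) (auto simp: det_four_block_mat_upper_right_zero[of _ n _ m])
  also have "?L * ?M = four_block_mat (1\<^sub>m n * 1\<^sub>m n + 0\<^sub>m n m * C) (1\<^sub>m n * B + 0\<^sub>m n m * 1\<^sub>m m)
      (- C * 1\<^sub>m n + 1\<^sub>m m * C) (- C * B + 1\<^sub>m m * 1\<^sub>m m)"
    by (rule mult_four_block_mat) (use carriers in auto)
  also have "\<dots> = four_block_mat (1\<^sub>m n) B (0\<^sub>m m n) (1\<^sub>m m - C * B)"
    using carriers products by (intro cong_four_block_mat eq_matI) auto
  also have "det \<dots> = det (1\<^sub>m m - C * B)"
    using carriers products
    by (simp add: det_four_block_mat_lower_left_zero[of _ n _ m] minus_carrier_mat)
  finally show ?thesis .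
qed

definition schur_complement :: "nat \<Rightarrow> (nat \<Rightarrow> nat \<Rightarrow> 'a) \<Rightarrow> nat \<Rightarrow> nat \<Rightarrow> 'a :: field" where
  "schur_complement N B i j = B i j - B i N * B N j / B N N"

lemma det_eq_pivot_mult_det_schur_complement:
  fixes B :: "nat \<Rightarrow> nat \<Rightarrow> 'a :: field"
  assumes "B N N \<noteq> 0"
  shows "det (kernel_mat (Suc N) B) = B N N * det (kernel_mat N (schur_complement N B))"
proof -
  let ?A = "kernel_mat N B" and ?b = "mat N 1 (\<lambda>(i,j). B i N)"
  let ?c = "mat 1 N (\<lambda>(i,j). B N j)" and ?d = "mat 1 1 (\<lambda>(i,j). B N N)"
  let ?E = "mat 1 N (\<lambda>(i,j). - B N j / B N N)"
  have "kernel_mat (Suc N) B = four_block_mat ?A ?b ?c ?d"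
    by (intro eq_matI) (auto simp: less_Suc_eq)
  also have "det \<dots> = det (?A + ?b * ?E) * det ?d"
    by (rule det_four_block_mat_eliminate_lower_left)
      (use assms in \<open>auto intro!: eq_matI simp: scalar_prod_def\<close>)
  also have "?A + ?b * ?E = kernel_mat N (schur_complement N B)"
    by (intro eq_matI) (auto simp: scalar_prod_def schur_complement_def)
  also have "det ?d = B N N"
    by (subst det_single) auto
  finally show ?thesis by simp
qed

section \<open>Hermitian forms\<close>

lemma vsqnorm_cong: "(\<And>i. i < n \<Longrightarrow> v i = w i) \<Longrightarrow> vsqnorm n v = vsqnorm n w"
  unfolding vsqnorm_def by (intro sum.cong refl) auto

lemma vsqnorm_nonneg [simp]: "0 \<le> vsqnorm n v"
  by (simp add: vsqnorm_def sum_nonneg)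

lemma vsqnorm_eq_0_iff: "vsqnorm n v = 0 \<longleftrightarrow> (\<forall>i<n. v i = 0)"
  by (auto simp: vsqnorm_def sum_nonneg_eq_0_iff)

lemma vsqnorm_pos: "\<exists>i<n. v i \<noteq> 0 \<Longrightarrow> 0 < vsqnorm n v"
  using vsqnorm_eq_0_iff[of n v] vsqnorm_nonneg[of n v] by (metis less_le)

lemma vsqnorm_scale: "vsqnorm n (\<lambda>i. c * v i) = (cmod c)\<^sup>2 * vsqnorm n v"
  by (simp add: vsqnorm_def norm_mult power_mult_distrib sum_distrib_left)

lemma complex_of_real_vsqnorm: "of_real (vsqnorm n v) = (\<Sum>i<n. cnj (v i) * v i)"
  by (simp add: vsqnorm_def complex_norm_square mult.commute del: of_real_power)

lemma norm_component_square_le_vsqnorm: "i < n \<Longrightarrow> (cmod (v i))\<^sup>2 \<le> vsqnorm n v"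
  unfolding vsqnorm_def by (rule member_le_sum[of i _ "\<lambda>i. (cmod (v i))\<^sup>2"]) auto

definition kernel_mult :: "nat \<Rightarrow> (nat \<Rightarrow> nat \<Rightarrow> complex) \<Rightarrow> (nat \<Rightarrow> complex) \<Rightarrow> nat \<Rightarrow> complex" where
  "kernel_mult N B v i = (\<Sum>j<N. B i j * v j)"

definition hform :: "nat \<Rightarrow> (nat \<Rightarrow> nat \<Rightarrow> complex) \<Rightarrow> (nat \<Rightarrow> complex) \<Rightarrow> complex" where
  "hform N B v = (\<Sum>i<N. \<Sum>j<N. cnj (v i) * B i j * v j)"

definition hermitian :: "nat \<Rightarrow> (nat \<Rightarrow> nat \<Rightarrow> complex) \<Rightarrow> bool" where
  "hermitian N B \<longleftrightarrow> (\<forall>i<N. \<forall>j<N. B j i = cnj (B i j))"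

definition pos_def :: "nat \<Rightarrow> (nat \<Rightarrow> nat \<Rightarrow> complex) \<Rightarrow> bool" where
  "pos_def N B \<longleftrightarrow> hermitian N B \<and> (\<forall>v. (\<exists>i<N. v i \<noteq> 0) \<longrightarrow> 0 < Re (hform N B v))"

lemma hermitianD: "hermitian N B \<Longrightarrow> i < N \<Longrightarrow> j < N \<Longrightarrow> B j i = cnj (B i j)"
  unfolding hermitian_def by blast

lemma pos_def_imp_hermitian: "pos_def N B \<Longrightarrow> hermitian N B"
  by (simp add: pos_def_def)

lemma kernel_mult_cong: "(\<And>j. j < N \<Longrightarrow> v j = w j) \<Longrightarrow> kernel_mult N B v = kernel_mult N B w"
  by (simp add: kernel_mult_def fun_eq_iff)

lemma hform_cong: "(\<And>i. i < N \<Longrightarrow> v i = w i) \<Longrightarrow> hform N B v = hform N B w"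
  unfolding hform_def by (intro sum.cong refl) auto

lemma hform_eq_inner_kernel_mult: "hform N B v = (\<Sum>i<N. cnj (v i) * kernel_mult N B v i)"
  by (simp add: hform_def kernel_mult_def sum_distrib_left mult.assoc)

lemma hform_scale: "hform n B (\<lambda>i. of_real c * v i) = of_real (c\<^sup>2) * hform n B v"
  unfolding hform_def sum_distrib_left
  by (intro sum.cong refl) (simp add: power2_eq_square)

lemma hform_unit_vector: "m < N \<Longrightarrow> hform N B (\<lambda>i. of_bool (i = m)) = B m m"
  by (simp add: hform_def of_bool_def if_distrib[of cnj] if_distrib[of "\<lambda>x. x * _"]
      if_distrib[of "\<lambda>x. _ * x"] cong: if_cong)

lemma hform_complete_square:
  assumes herm: "hermitian (Suc N) B" and pivot: "B N N = of_real a" and "a \<noteq> 0"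
  shows "Re (hform (Suc N) B v) = Re (hform N (schur_complement N B) v)
    + a * (cmod (v N + kernel_mult N B v N / of_real a))\<^sup>2"
proof -
  define c where "c = kernel_mult N B v N"
  have cnj_c: "(\<Sum>i<N. cnj (v i) * B i N) = cnj c"
    unfolding c_def kernel_mult_def cnj_sum
    by (intro sum.cong refl) (simp add: hermitianD[OF herm, of N] mult.commute)
  have "hform (Suc N) B v = hform N B v + cnj c * v N + cnj (v N) * c + cnj (v N) * B N N * v N"
    unfolding cnj_c[symmetric]
    by (simp add: hform_def c_def kernel_mult_def sum.distrib sum_distrib_left sum_distrib_right
        mult.assoc)
  moreover have "hform N (schur_complement N B) v = hform N B v - cnj c * c / of_real a"
  proof -
    have "hform N (schur_complement N B) v =
        hform N B v - (\<Sum>i<N. \<Sum>j<N. (cnj (v i) * B i N) * (B N j * v j)) / of_real a"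
      unfolding hform_def schur_complement_def pivot sum_divide_distrib sum_subtractf[symmetric]
      by (intro sum.cong refl) (simp add: algebra_simps)
    then show ?thesis
      by (simp add: sum_product[symmetric] cnj_c c_def kernel_mult_def)
  qed
  moreover have "a * (cmod (v N + c / of_real a))\<^sup>2 =
      Re (cnj c * v N + cnj (v N) * c + cnj (v N) * of_real a * v N + cnj c * c / of_real a)"
    using \<open>a \<noteq> 0\<close> unfolding cmod_power2 by (simp add: power2_eq_square field_simps)
  ultimately show ?thesis
    by (simp add: pivot c_def)
qed

lemma pos_def_pivot:
  assumes "pos_def (Suc N) B"
  obtains a where "0 < a" "B N N = of_real a"
proof
  have "B N N = cnj (B N N)"
    using assms by (intro hermitianD[of "Suc N"]) (auto simp: pos_def_def)
  then show "B N N = of_real (Re (B N N))"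
    by (simp add: complex_eq_iff)
  have "0 < Re (hform (Suc N) B (\<lambda>i. of_bool (i = N)))"
    using assms unfolding pos_def_def by (metis (full_types) lessI of_bool_eq(2) zero_neq_one)
  then show "0 < Re (B N N)"
    by (simp add: hform_unit_vector)
qed

lemma pos_def_schur_complement:
  assumes "pos_def (Suc N) B"
  shows "pos_def N (schur_complement N B)"
  unfolding pos_def_def
proof (intro conjI allI impI)
  have herm: "hermitian (Suc N) B"
    using assms by (rule pos_def_imp_hermitian)
  obtain a where "0 < a" and pivot: "B N N = of_real a"
    using pos_def_pivot[OF assms] .
  have entry_cnj: "B j i = cnj (B i j)" if "i \<le> N" "j \<le> N" for i j
    by (rule hermitianD[OF herm]) (use that in auto)
  show "hermitian N (schur_complement N B)"
    unfolding hermitian_def schur_complement_def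
  proof (intro allI impI)
    fix i j assume "i < N" "j < N"
    then show "B j i - B j N * B N i / B N N = cnj (B i j - B i N * B N j / B N N)"
      using entry_cnj[of i j] entry_cnj[of i N] entry_cnj[of N j] pivot by simp
  qed
  fix v :: "nat \<Rightarrow> complex" assume nonzero: "\<exists>i<N. v i \<noteq> 0"
  define w where "w = v(N := - kernel_mult N B v N / of_real a)"
  have "0 < Re (hform (Suc N) B w)"
    using assms nonzero unfolding pos_def_def w_def by (metis fun_upd_other less_SucI less_irrefl)
  also have "\<dots> = Re (hform N (schur_complement N B) w)
      + a * (cmod (w N + kernel_mult N B w N / of_real a))\<^sup>2"
    using \<open>0 < a\<close> by (intro hform_complete_square herm pivot) simp
  also have "kernel_mult N B w = kernel_mult N B v"
    by (rule kernel_mult_cong) (simp add: w_def)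
  also have "hform N (schur_complement N B) w = hform N (schur_complement N B) v"
    by (rule hform_cong) (simp add: w_def)
  finally show "0 < Re (hform N (schur_complement N B) v)"
    by (simp add: w_def)
qed

lemma pos_def_imp_det_pos: "pos_def N B \<Longrightarrow> 0 < Re (det (kernel_mat N B))"
proof (induction N arbitrary: B)
  case (Suc N)
  obtain a where "0 < a" and pivot: "B N N = of_real a"
    using pos_def_pivot[OF Suc.prems] .
  have "0 < Re (det (kernel_mat N (schur_complement N B)))"
    by (intro Suc.IH pos_def_schur_complement Suc.prems)
  then show ?case
    using \<open>0 < a\<close> pivot by (simp add: det_eq_pivot_mult_det_schur_complement)
qed simp

definition id_pencil :: "real \<Rightarrow> real \<Rightarrow> (nat \<Rightarrow> nat \<Rightarrow> complex) \<Rightarrow> nat \<Rightarrow> nat \<Rightarrow> complex" where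
  "id_pencil c t B i j = of_real c * of_bool (i = j) - of_real t * B i j"

lemma hermitian_id_pencil:
  assumes "hermitian N B"
  shows "hermitian N (id_pencil c t B)"
  unfolding hermitian_def
proof (intro allI impI)
  fix i j assume "i < N" "j < N"
  from hermitianD[OF assms this] show "id_pencil c t B j i = cnj (id_pencil c t B i j)"
    by (auto simp: id_pencil_def)
qed

lemma kernel_mult_id_pencil:
  assumes "i < N"
  shows "kernel_mult N (id_pencil c t B) v i = of_real c * v i - of_real t * kernel_mult N B v i"
proof -
  have "(\<Sum>j<N. of_real c * of_bool (i = j) * v j) = (\<Sum>j<N. if j = i then of_real c * v j else 0)"
    by (intro sum.cong) auto
  also have "\<dots> = of_real c * v i"
    using assms by simp
  finally show ?thesis
    unfolding kernel_mult_def id_pencil_def left_diff_distrib sum_subtractf sum_distrib_left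
    by (simp only: mult.assoc)
qed

lemma hform_id_pencil:
  "hform N (id_pencil c t B) v = of_real (c * vsqnorm N v) - of_real t * hform N B v"
proof -
  have "hform N (id_pencil c t B) v =
      (\<Sum>i<N. of_real c * (cnj (v i) * v i) - of_real t * (cnj (v i) * kernel_mult N B v i))"
    unfolding hform_eq_inner_kernel_mult
    by (intro sum.cong refl) (simp add: kernel_mult_id_pencil algebra_simps)
  then show ?thesis
    by (simp add: sum_subtractf sum_distrib_left[symmetric] complex_of_real_vsqnorm
        hform_eq_inner_kernel_mult)
qed

lemma Re_hform_diff_scaled:
  assumes "hermitian n B"
  shows "Re (hform n B (\<lambda>i. v i - of_real e * r i)) =
    Re (hform n B v) - 2 * e * Re (\<Sum>i<n. cnj (r i) * kernel_mult n B v i) + e\<^sup>2 * Re (hform n B r)"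
proof -
  define X where "X = (\<Sum>i<n. \<Sum>j<n. cnj (v i) * B i j * r j)"
  define Y where "Y = (\<Sum>i<n. \<Sum>j<n. cnj (r i) * B i j * v j)"
  have "cnj Y = (\<Sum>i<n. \<Sum>j<n. cnj (v j) * B j i * r i)"
    unfolding Y_def cnj_sum
    by (intro sum.cong refl) (simp add: hermitianD[OF assms, symmetric] ac_simps)
  also have "\<dots> = X"
    unfolding X_def by (rule sum.swap)
  finally have "Re X = Re Y"
    by (metis cnj.simps(1))
  moreover have "hform n B (\<lambda>i. v i - of_real e * r i) =
      hform n B v - of_real e * X - of_real e * Y + of_real (e\<^sup>2) * hform n B r"
    unfolding hform_def X_def Y_def sum_distrib_left sum_subtractf[symmetric] sum.distrib[symmetric]
    by (intro sum.cong refl) (simp add: algebra_simps power2_eq_square)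
  moreover have "Y = (\<Sum>i<n. cnj (r i) * kernel_mult n B v i)"
    by (simp add: Y_def kernel_mult_def sum_distrib_left mult.assoc)
  ultimately show ?thesis
    by (simp flip: of_real_power)
qed

lemma nonneg_quadratic_imp_linear_coeff_le_0:
  fixes c q :: real
  assumes "\<And>e. 0 \<le> e\<^sup>2 * c - 2 * e * q"
  shows "q \<le> 0"
proof (rule ccontr)
  assume "\<not> q \<le> 0"
  define e where "e = q / (\<bar>c\<bar> + 1)"
  have "0 < e"
    using \<open>\<not> q \<le> 0\<close> by (simp add: e_def)
  have "0 \<le> e * (e * c - 2 * q)"
    using assms[of e] by (simp add: power2_eq_square algebra_simps)
  then have "2 * q \<le> e * c"
    using \<open>0 < e\<close> by (simp add: zero_le_mult_iff)
  also have "e * c \<le> e * (\<bar>c\<bar> + 1)"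
    using \<open>0 < e\<close> by (intro mult_left_mono) auto
  also have "\<dots> = q"
    by (simp add: e_def)
  finally show False
    using \<open>\<not> q \<le> 0\<close> by simp
qed

text \<open>The form is nonnegative along the line through \<open>v\<close> in direction \<open>B v\<close> and vanishes at \<open>v\<close>,
  so its linear term, a multiple of the squared norm of \<open>B v\<close>, is zero.\<close>

lemma psd_hform_eq_0_imp_kernel_mult_eq_0:
  assumes "hermitian n B" "\<And>u. 0 \<le> Re (hform n B u)" "Re (hform n B v) = 0" "i < n"
  shows "kernel_mult n B v i = 0"
proof -
  let ?r = "kernel_mult n B v"
  have "0 \<le> e\<^sup>2 * Re (hform n B ?r) - 2 * e * vsqnorm n ?r" for e
    using assms(2)[of "\<lambda>i. v i - of_real e * ?r i"] assms(3)
    by (simp add: Re_hform_diff_scaled[OF assms(1)] flip: complex_of_real_vsqnorm)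
  then have "vsqnorm n ?r \<le> 0"
    by (rule nonneg_quadratic_imp_linear_coeff_le_0)
  then have "vsqnorm n ?r = 0"
    by (intro antisym vsqnorm_nonneg)
  then show ?thesis
    using \<open>i < n\<close> by (simp add: vsqnorm_eq_0_iff)
qed

section \<open>The largest eigenvalue of a Hermitian matrix\<close>

lemma compact_unit_vectors: "compact {v. vsqnorm n v = 1 \<and> (\<forall>i\<ge>n. v i = 0)}"
proof -
  let ?S = "\<lambda>i. if i < n then cball (0::complex) 1 else {0}"
  have "compactin (product_topology (\<lambda>_. euclidean) UNIV) (PiE UNIV ?S)"
    unfolding compactin_PiE by simp
  then have compact: "compact (PiE UNIV ?S)"
    by (simp add: euclidean_product_topology)
  have "continuous_on UNIV (\<lambda>v::nat \<Rightarrow> complex. vsqnorm n v)"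
    unfolding vsqnorm_def by (intro continuous_intros continuous_on_product_coordinates)
  then have closed: "closed {v. vsqnorm n v = 1}"
    by (intro closed_Collect_eq continuous_on_const)
  have "cmod (v i) \<le> 1" if "vsqnorm n v = 1" "i < n" for v i
    using norm_component_square_le_vsqnorm[OF that(2), of v] that(1) abs_square_le_1[of "cmod (v i)"]
    by simp
  then have "{v. vsqnorm n v = 1 \<and> (\<forall>i\<ge>n. v i = 0)} = {v. vsqnorm n v = 1} \<inter> PiE UNIV ?S"
    by (auto simp: PiE_iff not_less split: if_splits)
  then show ?thesis
    using closed_Int_compact[OF closed compact] by (simp only:)
qed

lemma hform_le_mult_vsqnorm:
  assumes "\<And>u. vsqnorm n u = 1 \<Longrightarrow> \<forall>i\<ge>n. u i = 0 \<Longrightarrow> Re (hform n B u) \<le> m"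
  shows "Re (hform n B u) \<le> m * vsqnorm n u"
proof (cases "vsqnorm n u = 0")
  case True
  then have "hform n B u = hform n B (\<lambda>_. 0)"
    by (intro hform_cong) (simp add: vsqnorm_eq_0_iff)
  then show ?thesis
    using True by (simp add: hform_def)
next
  case False
  then have "0 < vsqnorm n u"
    using vsqnorm_nonneg[of n u] by linarith
  define c where "c = 1 / sqrt (vsqnorm n u)"
  have c_square: "c\<^sup>2 = 1 / vsqnorm n u"
    using \<open>0 < vsqnorm n u\<close> by (simp add: c_def power_divide)
  let ?u = "\<lambda>i. if i < n then of_real c * u i else 0"
  have "vsqnorm n ?u = vsqnorm n (\<lambda>i. of_real c * u i)"
    by (rule vsqnorm_cong) simp
  then have "Re (hform n B ?u) \<le> m"
    using \<open>0 < vsqnorm n u\<close> by (intro assms) (simp_all add: vsqnorm_scale c_square)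
  also have "hform n B ?u = hform n B (\<lambda>i. of_real c * u i)"
    by (rule hform_cong) simp
  finally show ?thesis
    using \<open>0 < vsqnorm n u\<close> by (simp add: hform_scale c_square field_simps del: of_real_power)
qed

lemma hform_Rayleigh_max:
  assumes "n \<ge> 1"
  obtains v where "vsqnorm n v = 1" "\<And>u. Re (hform n B u) \<le> Re (hform n B v) * vsqnorm n u"
proof -
  let ?S = "{v. vsqnorm n v = 1 \<and> (\<forall>i\<ge>n. v i = 0)}"
  have "(\<lambda>i. of_bool (i = 0)) \<in> ?S"
    using assms
    by (auto simp: vsqnorm_def of_bool_def if_distrib[of cmod] if_distrib[of "\<lambda>x. x\<^sup>2"] cong: if_cong)
  then have "?S \<noteq> {}" by blast
  moreover have "continuous_on UNIV (\<lambda>v. Re (hform n B v))"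
    unfolding hform_def by (intro continuous_intros continuous_on_product_coordinates)
  then have "continuous_on ?S (\<lambda>v. Re (hform n B v))"
    by (rule continuous_on_subset) simp
  ultimately have "\<exists>v\<in>?S. \<forall>u\<in>?S. Re (hform n B u) \<le> Re (hform n B v)"
    by (rule continuous_attains_sup[OF compact_unit_vectors])
  then obtain v where "vsqnorm n v = 1"
    and "\<And>u. vsqnorm n u = 1 \<Longrightarrow> \<forall>i\<ge>n. u i = 0 \<Longrightarrow> Re (hform n B u) \<le> Re (hform n B v)"
    by blast
  then show ?thesis
    by (intro that hform_le_mult_vsqnorm)
qed

lemma eigenvalue_kernel_matI:
  assumes "\<exists>i<n. v i \<noteq> 0" "\<And>i. i < n \<Longrightarrow> kernel_mult n B v i = e * v i"
  shows "eigenvalue (kernel_mat n B) e"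
proof -
  have "kernel_mat n B *\<^sub>v vec n v = e \<cdot>\<^sub>v vec n v"
    using assms(2) by (intro eq_vecI) (auto simp: scalar_prod_def kernel_mult_def lessThan_atLeast0)
  moreover have "vec n v \<noteq> 0\<^sub>v n"
    using assms(1) by (metis index_vec index_zero_vec(1))
  ultimately show ?thesis
    unfolding eigenvalue_def eigenvector_def by (intro exI[of _ "vec n v"]) simp
qed

definition max_eigenvalue :: "nat \<Rightarrow> (nat \<Rightarrow> nat \<Rightarrow> complex) \<Rightarrow> real" where
  "max_eigenvalue n B = Max {e. eigenvalue (kernel_mat n B) (complex_of_real e)}"

lemma finite_real_eigenvalues:
  assumes "(A :: complex mat) \<in> carrier_mat n n"
  shows "finite {e::real. eigenvalue A (complex_of_real e)}"
proof -
  have "char_poly A \<noteq> 0"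
    using degree_monic_char_poly[OF assms] by auto
  then have "finite {k. poly (char_poly A) k = 0}"
    by (rule poly_roots_finite)
  then have "finite (complex_of_real -` {k. poly (char_poly A) k = 0})"
    by (rule finite_vimageI) (simp add: inj_on_def)
  then show ?thesis
    by (simp add: eigenvalue_root_char_poly[OF assms] vimage_def)
qed

lemma hform_le_max_eigenvalue:
  assumes herm: "hermitian n B" and "n \<ge> 1"
  shows "Re (hform n B u) \<le> max_eigenvalue n B * vsqnorm n u"
proof -
  obtain v where unit: "vsqnorm n v = 1"
    and bound: "\<And>u. Re (hform n B u) \<le> Re (hform n B v) * vsqnorm n u"
    using hform_Rayleigh_max[OF \<open>n \<ge> 1\<close>] by blast
  define \<mu> where "\<mu> = Re (hform n B v)"
  have "kernel_mult n B v i = of_real \<mu> * v i" if "i < n" for i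
  proof -
    have "kernel_mult n (id_pencil \<mu> 1 B) v i = 0"
      using unit bound that
      by (intro psd_hform_eq_0_imp_kernel_mult_eq_0 hermitian_id_pencil herm)
        (auto simp: hform_id_pencil \<mu>_def)
    then show ?thesis
      using that by (simp add: kernel_mult_id_pencil)
  qed
  moreover have "\<exists>i<n. v i \<noteq> 0"
    using unit vsqnorm_eq_0_iff[of n v] by auto
  ultimately have "eigenvalue (kernel_mat n B) (of_real \<mu>)"
    by (intro eigenvalue_kernel_matI)
  then have "\<mu> \<le> max_eigenvalue n B"
    unfolding max_eigenvalue_def by (intro Max_ge finite_real_eigenvalues[of _ n]) auto
  then have "\<mu> * vsqnorm n u \<le> max_eigenvalue n B * vsqnorm n u"
    by (rule mult_right_mono) simp
  then show ?thesis
    using bound[of u] by (simp add: \<mu>_def)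
qed

section \<open>Gram matrices\<close>

definition kernel_adjoint :: "(nat \<Rightarrow> nat \<Rightarrow> complex) \<Rightarrow> nat \<Rightarrow> nat \<Rightarrow> complex" where
  "kernel_adjoint X k i = cnj (X i k)"

definition gram_kernel :: "nat \<Rightarrow> (nat \<Rightarrow> nat \<Rightarrow> complex) \<Rightarrow> nat \<Rightarrow> nat \<Rightarrow> complex" where
  "gram_kernel N X i j = (\<Sum>k<N. X i k * cnj (X j k))"

lemma kernel_adjoint_adjoint [simp]: "kernel_adjoint (kernel_adjoint X) = X"
  by (simp add: fun_eq_iff kernel_adjoint_def)

lemma hermitian_gram_kernel: "hermitian n (gram_kernel N X)"
  by (simp add: hermitian_def gram_kernel_def mult.commute)

lemma inner_kernel_mult_adjoint:
  "(\<Sum>k<N. cnj (v k) * kernel_mult n (kernel_adjoint X) y k) = (\<Sum>i<n. cnj (kernel_mult N X v i) * y i)"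
  unfolding kernel_mult_def kernel_adjoint_def cnj_sum sum_distrib_left sum_distrib_right
  by (subst sum.swap) (simp add: ac_simps)

lemma kernel_mult_gram_kernel:
  "kernel_mult n (gram_kernel N X) u = kernel_mult N X (kernel_mult n (kernel_adjoint X) u)"
  unfolding kernel_mult_def gram_kernel_def kernel_adjoint_def sum_distrib_left sum_distrib_right
  by (subst sum.swap) (simp add: mult.assoc)

lemma hform_gram_kernel:
  "hform n (gram_kernel N X) u = of_real (vsqnorm N (kernel_mult n (kernel_adjoint X) u))"
  using inner_kernel_mult_adjoint[where N = n and n = N and X = "kernel_adjoint X"]
  by (simp add: hform_eq_inner_kernel_mult kernel_mult_gram_kernel complex_of_real_vsqnorm)

lemma vsqnorm_kernel_mult_le_of_adjoint:
  assumes adjoint: "\<And>u. vsqnorm N (kernel_mult n (kernel_adjoint X) u) \<le> c * vsqnorm n u" and "0 \<le> c"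
  shows "vsqnorm n (kernel_mult N X v) \<le> c * vsqnorm N v"
proof -
  let ?y = "kernel_mult N X v"
  let ?w = "kernel_mult n (kernel_adjoint X) ?y"
  have "vsqnorm n ?y = cmod (\<Sum>k<N. cnj (v k) * ?w k)"
    unfolding inner_kernel_mult_adjoint by (simp flip: complex_of_real_vsqnorm)
  also have "\<dots> \<le> (\<Sum>k<N. cmod (v k) * cmod (?w k))"
    by (rule sum_norm_le) (simp add: norm_mult)
  finally have "(vsqnorm n ?y)\<^sup>2 \<le> (\<Sum>k<N. cmod (v k) * cmod (?w k))\<^sup>2"
    by (intro power_mono) simp_all
  also have "\<dots> \<le> vsqnorm N v * vsqnorm N ?w"
    unfolding vsqnorm_def by (rule Cauchy_Schwarz_ineq_sum)
  also have "\<dots> \<le> vsqnorm N v * (c * vsqnorm n ?y)"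
    by (intro mult_left_mono adjoint) simp
  finally have "vsqnorm n ?y * vsqnorm n ?y \<le> c * vsqnorm N v * vsqnorm n ?y"
    by (simp add: power2_eq_square ac_simps)
  then show ?thesis
    using \<open>0 \<le> c\<close> vsqnorm_nonneg[of n ?y] by (cases "vsqnorm n ?y = 0") auto
qed

lemma max_eigenvalue_gram_kernel_nonneg:
  assumes "n \<ge> 1"
  shows "0 \<le> max_eigenvalue n (gram_kernel N X)"
proof -
  let ?e = "\<lambda>i. of_bool (i = 0)"
  have "vsqnorm N (kernel_mult n (kernel_adjoint X) ?e)
      \<le> max_eigenvalue n (gram_kernel N X) * vsqnorm n ?e"
    using hform_le_max_eigenvalue[OF hermitian_gram_kernel assms, of N X ?e]
    by (simp add: hform_gram_kernel)
  then have "0 \<le> max_eigenvalue n (gram_kernel N X) * vsqnorm n ?e"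
    using vsqnorm_nonneg by (rule order_trans[rotated])
  moreover have "0 < vsqnorm n ?e"
    by (rule vsqnorm_pos) (use assms in auto)
  ultimately show ?thesis
    by (simp add: zero_le_mult_iff)
qed

abbreviation adjoint_gram_form :: "nat \<Rightarrow> real \<Rightarrow> (nat \<Rightarrow> nat \<Rightarrow> complex) \<Rightarrow> nat \<Rightarrow> nat \<Rightarrow> complex" where
  "adjoint_gram_form n t X \<equiv> id_pencil 1 t (gram_kernel n (kernel_adjoint X))"

lemma pos_def_adjoint_gram_form:
  assumes "n \<ge> 1" and t_bound: "t * max_eigenvalue n (gram_kernel N X) < 1"
  shows "pos_def N (adjoint_gram_form n t X)"
  unfolding pos_def_def
proof (intro conjI allI impI hermitian_id_pencil hermitian_gram_kernel)
  fix v assume "\<exists>k<N. v k \<noteq> (0::complex)"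
  then have "0 < vsqnorm N v"
    by (rule vsqnorm_pos)
  let ?max = "max_eigenvalue n (gram_kernel N X)"
  let ?y = "kernel_mult N X v"
  have norm_y: "vsqnorm n ?y \<le> ?max * vsqnorm N v"
  proof (rule vsqnorm_kernel_mult_le_of_adjoint)
    show "vsqnorm N (kernel_mult n (kernel_adjoint X) u) \<le> ?max * vsqnorm n u" for u
      using hform_le_max_eigenvalue[OF hermitian_gram_kernel \<open>n \<ge> 1\<close>, of N X u]
      by (simp add: hform_gram_kernel)
  qed (rule max_eigenvalue_gram_kernel_nonneg[OF \<open>n \<ge> 1\<close>])
  have "t * vsqnorm n ?y < vsqnorm N v"
  proof (cases "0 \<le> t")
    case True
    then have "t * vsqnorm n ?y \<le> t * ?max * vsqnorm N v"
      using norm_y by (simp add: mult_left_mono mult.assoc)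
    also have "\<dots> < 1 * vsqnorm N v"
      using t_bound \<open>0 < vsqnorm N v\<close> by (rule mult_strict_right_mono)
    finally show ?thesis by simp
  next
    case False
    then have "t * vsqnorm n ?y \<le> 0"
      by (simp add: mult_nonpos_nonneg)
    then show ?thesis
      using \<open>0 < vsqnorm N v\<close> by linarith
  qed
  then show "0 < Re (hform N (adjoint_gram_form n t X) v)"
    by (simp add: hform_id_pencil hform_gram_kernel)
qed

lemma det_one_minus_smult_one_plus_gram:
  fixes s :: real
  assumes "s \<noteq> 1"
  shows "det (1\<^sub>m n - complex_of_real s \<cdot>\<^sub>m (1\<^sub>m n + kernel_mat n (gram_kernel N X))) =
    of_real ((1 - s) ^ n) * det (kernel_mat N (adjoint_gram_form n (s / (1 - s)) X))"
proof -
  define t where "t = s / (1 - s)"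
  let ?X = "mat n N (\<lambda>(i,k). X i k)" and ?Y = "mat N n (\<lambda>(k,j). of_real t * cnj (X j k))"
  have "s = (1 - s) * t"
    using assms by (simp add: t_def)
  then have "complex_of_real s = (1 - of_real s) * of_real t"
    by (metis of_real_1 of_real_diff of_real_mult)
  then have entry: "d - complex_of_real s * (d + g) = (1 - of_real s) * (d - of_real t * g)" for d g
    by (simp add: right_diff_distrib left_diff_distrib distrib_left flip: mult.assoc)
  have product: "?X * ?Y = of_real t \<cdot>\<^sub>m kernel_mat n (gram_kernel N X)"
    by (intro eq_matI)
      (auto simp: scalar_prod_def gram_kernel_def lessThan_atLeast0 sum_distrib_left ac_simps)
  have "1\<^sub>m n - complex_of_real s \<cdot>\<^sub>m (1\<^sub>m n + kernel_mat n (gram_kernel N X)) =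
      of_real (1 - s) \<cdot>\<^sub>m (1\<^sub>m n - ?X * ?Y)"
    unfolding product by (intro eq_matI) (simp_all add: entry)
  then have "det (1\<^sub>m n - complex_of_real s \<cdot>\<^sub>m (1\<^sub>m n + kernel_mat n (gram_kernel N X))) =
      of_real ((1 - s) ^ n) * det (1\<^sub>m n - ?X * ?Y)"
    by simp
  also have "det (1\<^sub>m n - ?X * ?Y) = det (1\<^sub>m N - ?Y * ?X)"
    by (rule det_one_minus_mult_commute) auto
  also have "1\<^sub>m N - ?Y * ?X = kernel_mat N (adjoint_gram_form n t X)"
    by (intro eq_matI)
      (auto simp: scalar_prod_def id_pencil_def gram_kernel_def kernel_adjoint_def lessThan_atLeast0
        sum_distrib_left ac_simps)
  finally show ?thesis
    by (simp add: t_def)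
qed

section \<open>Moment generating function of the received energy\<close>

lemma borel_measurable_vsqnorm [measurable (raw)]:
  assumes "\<And>i. i < n \<Longrightarrow> (\<lambda>x. f x i) \<in> borel_measurable M"
  shows "(\<lambda>x. vsqnorm n (f x)) \<in> borel_measurable M"
  unfolding vsqnorm_def using assms by (intro borel_measurable_sum) auto

lemma borel_measurable_hform [measurable (raw)]:
  assumes "\<And>i. i < N \<Longrightarrow> (\<lambda>x. f x i) \<in> borel_measurable M"
  shows "(\<lambda>x. hform N B (f x)) \<in> borel_measurable M"
  unfolding hform_def using assms
  by (intro borel_measurable_sum borel_measurable_times borel_measurable_const
      borel_measurable_continuous_on[of cnj] continuous_intros) auto

lemma vsqnorm_minus_hform_fun_upd:
  assumes "hermitian (Suc N) B" "B N N = of_real a" "a \<noteq> 0"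
  shows "vsqnorm (Suc N) (u(N := z)) - Re (hform (Suc N) B (u(N := z))) =
    (vsqnorm N u - Re (hform N (schur_complement N B) u))
      + ((cmod z)\<^sup>2 - a * (cmod (z + kernel_mult N B u N / of_real a))\<^sup>2)"
proof -
  have "hform N (schur_complement N B) (u(N := z)) = hform N (schur_complement N B) u"
    by (rule hform_cong) simp
  moreover have "vsqnorm N (u(N := z)) = vsqnorm N u"
    by (rule vsqnorm_cong) simp
  moreover have "kernel_mult N B (u(N := z)) = kernel_mult N B u"
    by (rule kernel_mult_cong) simp
  ultimately show ?thesis
    using hform_complete_square[OF assms, of "u(N := z)"] by (simp add: vsqnorm_def)
qed

lemma nn_integral_PiM_cgauss_pos_def:
  assumes "pos_def N B"
  shows "(\<integral>\<^sup>+u. ennreal (exp (vsqnorm N u - Re (hform N B u))) \<partial>PiM {..<N} (\<lambda>_. cgauss 1)) =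
    ennreal (1 / Re (det (kernel_mat N B)))"
  using assms
proof (induction N arbitrary: B)
  case 0
  show ?case
    by (simp add: PiM_empty nn_integral_count_space_finite vsqnorm_def hform_def)
next
  case (Suc N)
  interpret product_prob_space "\<lambda>_. cgauss 1" "{..<N}"
    by (intro product_prob_spaceI prob_space_cgauss) simp
  obtain a where "0 < a" and pivot: "B N N = of_real a"
    using pos_def_pivot[OF Suc.prems] .
  let ?S = "schur_complement N B"
  have schur_pos_def: "pos_def N ?S"
    using Suc.prems by (rule pos_def_schur_complement)
  have split: "vsqnorm (Suc N) (u(N := z)) - Re (hform (Suc N) B (u(N := z))) =
      (vsqnorm N u - Re (hform N ?S u))
        + ((cmod z)\<^sup>2 - a * (cmod (z + kernel_mult N B u N / of_real a))\<^sup>2)" for u z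
    using \<open>0 < a\<close> by (intro vsqnorm_minus_hform_fun_upd pos_def_imp_hermitian Suc.prems pivot) simp
  have "(\<lambda>u. vsqnorm (Suc N) u - Re (hform (Suc N) B u))
      \<in> borel_measurable (PiM {..<Suc N} (\<lambda>_. cgauss 1))"
    by measurable
  then have "(\<integral>\<^sup>+u. ennreal (exp (vsqnorm (Suc N) u - Re (hform (Suc N) B u)))
        \<partial>PiM (insert N {..<N}) (\<lambda>_. cgauss 1)) =
      (\<integral>\<^sup>+u. \<integral>\<^sup>+z. ennreal (exp (vsqnorm (Suc N) (u(N := z)) - Re (hform (Suc N) B (u(N := z)))))
        \<partial>cgauss 1 \<partial>PiM {..<N} (\<lambda>_. cgauss 1))"
    by (intro product_nn_integral_insert) (simp_all flip: lessThan_Suc)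
  also have "\<dots> = (\<integral>\<^sup>+u. ennreal (exp (vsqnorm N u - Re (hform N ?S u))) * ennreal (1 / a)
        \<partial>PiM {..<N} (\<lambda>_. cgauss 1))"
    unfolding split exp_add using \<open>0 < a\<close>
    by (simp add: ennreal_mult nn_integral_cmult nn_integral_cgauss_exp_quadratic[of 1, simplified])
  also have "\<dots> = ennreal (1 / Re (det (kernel_mat N ?S))) * ennreal (1 / a)"
    by (simp add: nn_integral_multc Suc.IH[OF schur_pos_def])
  also have "\<dots> = ennreal (1 / Re (det (kernel_mat (Suc N) B)))"
    using \<open>0 < a\<close> pivot pos_def_imp_det_pos[OF schur_pos_def]
    by (simp add: det_eq_pivot_mult_det_schur_complement ennreal_mult'[symmetric] mult.commute)
  finally show ?case
    by (simp add: lessThan_Suc)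
qed

lemma nn_integral_PiM_cgauss_gram:
  assumes "pos_def N (adjoint_gram_form n t X)"
  shows "(\<integral>\<^sup>+u. ennreal (exp (t * vsqnorm n (kernel_mult N X u))) \<partial>PiM {..<N} (\<lambda>_. cgauss 1)) =
    ennreal (1 / Re (det (kernel_mat N (adjoint_gram_form n t X))))"
  using nn_integral_PiM_cgauss_pos_def[OF assms] by (simp add: hform_id_pencil hform_gram_kernel)

lemma nn_integral_cgauss_shift:
  assumes "s < 1"
  shows "(\<integral>\<^sup>+z. ennreal (exp (s * (cmod (b + z))\<^sup>2)) \<partial>cgauss 1) =
    ennreal (exp (s / (1 - s) * (cmod b)\<^sup>2) / (1 - s))"
proof -
  define t where "t = s / (1 - s)"
  define c where "c = - of_real t * b"
  have s_eq: "(1 - s) * t = s"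
    using assms by (simp add: t_def)
  have "s * (x + y)\<^sup>2 = t * x\<^sup>2 + (y\<^sup>2 - (1 - s) * (y - t * x)\<^sup>2)" for x y
  proof -
    have "(1 - s) * (y - t * x)\<^sup>2 =
        (1 - s) * y\<^sup>2 - 2 * ((1 - s) * t) * (x * y) + ((1 - s) * t) * (t * x\<^sup>2)"
      by (simp add: power2_eq_square algebra_simps)
    moreover have "t * x\<^sup>2 - s * (t * x\<^sup>2) = ((1 - s) * t) * x\<^sup>2"
      by (simp add: algebra_simps)
    ultimately show ?thesis
      unfolding s_eq by (simp add: power2_eq_square algebra_simps)
  qed
  then have complete_square:
    "s * (cmod (b + z))\<^sup>2 = t * (cmod b)\<^sup>2 + ((cmod z)\<^sup>2 - (1 - s) * (cmod (z + c))\<^sup>2)" for z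
    by (simp add: cmod_power2 c_def distrib_left)
  have "(\<integral>\<^sup>+z. ennreal (exp (s * (cmod (b + z))\<^sup>2)) \<partial>cgauss 1) =
      (\<integral>\<^sup>+z. ennreal (exp (t * (cmod b)\<^sup>2)) *
        ennreal (exp ((cmod z)\<^sup>2 - (1 - s) * (cmod (z + c))\<^sup>2)) \<partial>cgauss 1)"
    unfolding complete_square exp_add by (simp add: ennreal_mult)
  also have "\<dots> = ennreal (exp (t * (cmod b)\<^sup>2)) * ennreal (1 / (1 - s))"
    using assms nn_integral_cgauss_exp_quadratic[of 1 "1 - s" c] by (simp add: nn_integral_cmult)
  finally show ?thesis
    using assms by (simp add: t_def flip: ennreal_mult)
qed

lemma nn_integral_PiM_cgauss_shift:
  assumes "s < 1"
  shows "(\<integral>\<^sup>+z. ennreal (exp (s * vsqnorm n (\<lambda>i. b i + z i))) \<partial>PiM {..<n} (\<lambda>_. cgauss 1)) =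
    ennreal (exp (s / (1 - s) * vsqnorm n b) / (1 - s) ^ n)"
proof -
  interpret product_prob_space "\<lambda>_. cgauss 1" "{..<n}"
    by (intro product_prob_spaceI prob_space_cgauss) simp
  have "(\<integral>\<^sup>+z. ennreal (exp (s * vsqnorm n (\<lambda>i. b i + z i))) \<partial>PiM {..<n} (\<lambda>_. cgauss 1)) =
      (\<integral>\<^sup>+z. (\<Prod>i<n. ennreal (exp (s * (cmod (b i + z i))\<^sup>2))) \<partial>PiM {..<n} (\<lambda>_. cgauss 1))"
    by (simp add: vsqnorm_def sum_distrib_left exp_sum prod_ennreal)
  also have "\<dots> = (\<Prod>i<n. ennreal (exp (s / (1 - s) * (cmod (b i))\<^sup>2) / (1 - s)))"
    by (subst product_nn_integral_prod) (simp_all add: nn_integral_cgauss_shift[OF assms])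
  also have "\<dots> = ennreal (exp (s / (1 - s) * vsqnorm n b) / (1 - s) ^ n)"
    using assms by (simp add: prod_ennreal prod_dividef exp_sum vsqnorm_def sum_distrib_left)
  finally show ?thesis .
qed

definition channel_measure ::
    "nat \<Rightarrow> nat \<Rightarrow> nat \<Rightarrow> ((nat \<Rightarrow> nat \<Rightarrow> complex) \<times> (nat \<Rightarrow> nat \<Rightarrow> complex)) measure" where
  "channel_measure n L N = fading_measure N L \<Otimes>\<^sub>M noise_measure n L"

definition energy_det :: "nat \<Rightarrow> nat \<Rightarrow> (nat \<Rightarrow> nat \<Rightarrow> complex) \<Rightarrow> real \<Rightarrow> real" where
  "energy_det n N X s =
    Re (det (1\<^sub>m n - complex_of_real s \<cdot>\<^sub>m (1\<^sub>m n + kernel_mat n (gram_kernel N X))))"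

lemma energy_det_eq:
  "s \<noteq> 1 \<Longrightarrow> energy_det n N X s =
    (1 - s) ^ n * Re (det (kernel_mat N (adjoint_gram_form n (s / (1 - s)) X)))"
  by (simp add: energy_det_def det_one_minus_smult_one_plus_gram flip: of_real_diff of_real_power)

definition received_energy :: "nat \<Rightarrow> nat \<Rightarrow> nat \<Rightarrow> (nat \<Rightarrow> nat \<Rightarrow> complex)
    \<Rightarrow> (nat \<Rightarrow> nat \<Rightarrow> complex) \<times> (nat \<Rightarrow> nat \<Rightarrow> complex) \<Rightarrow> real" where
  "received_energy n L N X = (\<lambda>(h, z). \<Sum>l<L. vsqnorm n (\<lambda>i. kernel_mult N X (\<lambda>k. h k l) i + z l i))"

lemma prob_space_fading_measure: "prob_space (fading_measure N L)"
  unfolding fading_measure_def by (intro prob_space_PiM prob_space_cgauss) simp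

lemma prob_space_noise_measure: "prob_space (noise_measure n L)"
  unfolding noise_measure_def by (intro prob_space_PiM prob_space_cgauss) simp

lemma prob_space_channel_measure: "prob_space (channel_measure n L N)"
  unfolding channel_measure_def
  by (intro prob_space_pair prob_space_fading_measure prob_space_noise_measure)

lemma borel_measurable_kernel_mult [measurable (raw)]:
  assumes "\<And>j. j < N \<Longrightarrow> (\<lambda>x. f x j) \<in> borel_measurable M"
  shows "(\<lambda>x. kernel_mult N B (f x) i) \<in> borel_measurable M"
  unfolding kernel_mult_def using assms by (intro borel_measurable_sum borel_measurable_times) auto

lemma measurable_PiM_PiM_cgauss_component:
  assumes "k < N" "l < L"
  shows "(\<lambda>h. h k l) \<in> borel_measurable (PiM {..<N} (\<lambda>_. PiM {..<L} (\<lambda>_. cgauss v)))"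
  using measurable_PiM_PiM_component[of k "{..<N}" l "{..<L}" "\<lambda>_ _. cgauss v"] assms by simp

lemma borel_measurable_received_energy [measurable]:
  "received_energy n L N X \<in> borel_measurable (channel_measure n L N)"
proof -
  have "(\<lambda>h. h k l) \<in> borel_measurable (fading_measure N L)" if "k < N" "l < L" for k l
    unfolding fading_measure_def using that by (intro measurable_PiM_PiM_cgauss_component)
  from measurable_compose[OF measurable_fst this]
  have [measurable]: "(\<lambda>p. fst p k l) \<in> borel_measurable (channel_measure n L N)"
    if "k < N" "l < L" for k l
    unfolding channel_measure_def using that .
  have "(\<lambda>z. z l i) \<in> borel_measurable (noise_measure n L)" if "l < L" "i < n" for l i
    unfolding noise_measure_def using that by (intro measurable_PiM_PiM_cgauss_component)
  from measurable_compose[OF measurable_snd this]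
  have [measurable]: "(\<lambda>p. snd p l i) \<in> borel_measurable (channel_measure n L N)"
    if "l < L" "i < n" for l i
    unfolding channel_measure_def using that .
  show ?thesis
    unfolding received_energy_def case_prod_beta by measurable
qed

lemma nn_integral_noise_received_energy:
  assumes "s < 1"
  shows "(\<integral>\<^sup>+z. ennreal (exp (s * received_energy n L N X (h, z))) \<partial>noise_measure n L) =
    (\<Prod>l<L. ennreal (exp (s / (1 - s) * vsqnorm n (kernel_mult N X (\<lambda>k. h k l))) / (1 - s) ^ n))"
proof -
  let ?G = "PiM {..<n} (\<lambda>_. cgauss 1)"
  interpret product_prob_space "\<lambda>_. ?G" "{..<L}"
    by (intro product_prob_spaceI prob_space_PiM prob_space_cgauss) simp
  have "(\<integral>\<^sup>+z. ennreal (exp (s * received_energy n L N X (h, z))) \<partial>noise_measure n L) =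
      (\<integral>\<^sup>+z. (\<Prod>l<L. ennreal (exp (s * vsqnorm n (\<lambda>i. kernel_mult N X (\<lambda>k. h k l) i + z l i))))
        \<partial>PiM {..<L} (\<lambda>_. ?G))"
    by (simp add: received_energy_def noise_measure_def sum_distrib_left exp_sum prod_ennreal)
  also have "\<dots> =
      (\<Prod>l<L. \<integral>\<^sup>+z. ennreal (exp (s * vsqnorm n (\<lambda>i. kernel_mult N X (\<lambda>k. h k l) i + z i))) \<partial>?G)"
    by (intro product_nn_integral_prod) measurable
  finally show ?thesis
    by (simp only: nn_integral_PiM_cgauss_shift[OF assms])
qed

lemma nn_integral_fading_gram:
  assumes "pos_def N (adjoint_gram_form n t X)" "0 \<le> c"
  shows "(\<integral>\<^sup>+h. (\<Prod>l<L. ennreal (exp (t * vsqnorm n (kernel_mult N X (\<lambda>k. h k l))) / c))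
      \<partial>fading_measure N L) =
    ennreal (1 / (c * Re (det (kernel_mat N (adjoint_gram_form n t X))))) ^ L"
proof -
  let ?f = "\<lambda>u. ennreal (exp (t * vsqnorm n (kernel_mult N X u)) / c)"
  have "kernel_mult N X (\<lambda>k\<in>{..<N}. h k l) = kernel_mult N X (\<lambda>k. h k l)"
    for h :: "nat \<Rightarrow> nat \<Rightarrow> complex" and l
    by (rule kernel_mult_cong) simp
  then have "(\<integral>\<^sup>+h. (\<Prod>l<L. ?f (\<lambda>k. h k l)) \<partial>fading_measure N L) =
      (\<Prod>l<L. \<integral>\<^sup>+u. ?f u \<partial>PiM {..<N} (\<lambda>_. cgauss 1))"
    unfolding fading_measure_def
    using nn_integral_PiM_columns[of "cgauss 1" "{..<N}" "{..<L}" "\<lambda>_. ?f"]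
    by (simp add: prob_space_cgauss)
  also have "(\<integral>\<^sup>+u. ?f u \<partial>PiM {..<N} (\<lambda>_. cgauss 1)) =
      ennreal (1 / c) *
        (\<integral>\<^sup>+u. ennreal (exp (t * vsqnorm n (kernel_mult N X u))) \<partial>PiM {..<N} (\<lambda>_. cgauss 1))"
    using \<open>0 \<le> c\<close> by (subst nn_integral_cmult[symmetric]) (simp_all flip: ennreal_mult')
  finally show ?thesis
    using \<open>0 \<le> c\<close> by (simp add: nn_integral_PiM_cgauss_gram[OF assms(1)] flip: ennreal_mult')
qed

lemma mgf_received_energy:
  assumes "n \<ge> 1" and s_bound: "s * (1 + max_eigenvalue n (gram_kernel N X)) < 1"
  shows "0 < energy_det n N X s"
    and "(\<integral>\<^sup>+p. ennreal (exp (s * received_energy n L N X p)) \<partial>channel_measure n L N) =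
      ennreal (1 / energy_det n N X s) ^ L"
proof -
  let ?max = "max_eigenvalue n (gram_kernel N X)"
  let ?form = "adjoint_gram_form n (s / (1 - s)) X"
  have "0 \<le> ?max"
    using \<open>n \<ge> 1\<close> by (rule max_eigenvalue_gram_kernel_nonneg)
  then have "s < 1"
    using s_bound by (smt (verit) mult_less_cancel_left2)
  then have "s / (1 - s) * ?max < 1"
    using s_bound by (simp add: field_simps)
  with \<open>n \<ge> 1\<close> have form_pos_def: "pos_def N ?form"
    by (rule pos_def_adjoint_gram_form)
  have det_eq: "energy_det n N X s = (1 - s) ^ n * Re (det (kernel_mat N ?form))"
    using \<open>s < 1\<close> by (intro energy_det_eq) simp
  then show "0 < energy_det n N X s"
    using pos_def_imp_det_pos[OF form_pos_def] \<open>s < 1\<close> by simp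
  interpret noise: prob_space "noise_measure n L"
    by (rule prob_space_noise_measure)
  have "(\<integral>\<^sup>+p. ennreal (exp (s * received_energy n L N X p)) \<partial>channel_measure n L N) =
      (\<integral>\<^sup>+h. \<integral>\<^sup>+z. ennreal (exp (s * received_energy n L N X (h, z)))
        \<partial>noise_measure n L \<partial>fading_measure N L)"
    using borel_measurable_received_energy[of n L N X]
    unfolding channel_measure_def by (subst noise.nn_integral_fst) simp_all
  also have "\<dots> = ennreal (1 / energy_det n N X s) ^ L"
    unfolding nn_integral_noise_received_energy[OF \<open>s < 1\<close>] det_eq
    using \<open>s < 1\<close> by (intro nn_integral_fading_gram form_pos_def) simp
  finally show "(\<integral>\<^sup>+p. ennreal (exp (s * received_energy n L N X p)) \<partial>channel_measure n L N) =
      ennreal (1 / energy_det n N X s) ^ L" .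
qed

section \<open>Chernoff bounds on the received energy\<close>

lemma chernoff_received_energy:
  assumes "n \<ge> 1" "s * (1 + max_eigenvalue n (gram_kernel N X)) < 1"
  shows "measure (channel_measure n L N)
      {p \<in> space (channel_measure n L N). s * T \<le> s * received_energy n L N X p}
    \<le> exp (- s * T - real L * ln (energy_det n N X s))"
proof -
  let ?H = "channel_measure n L N"
  interpret prob_space ?H
    by (rule prob_space_channel_measure)
  have "emeasure ?H {p \<in> space ?H. s * T \<le> s * received_energy n L N X p} \<le>
      ennreal (exp (- 1 * (s * T))) *
        (\<integral>\<^sup>+p. ennreal (exp (1 * (s * received_energy n L N X p))) * indicator (space ?H) p \<partial>?H)"
    by (rule Chernoff_ineq_nn_integral_ge) measurable
  also have "(\<integral>\<^sup>+p. ennreal (exp (1 * (s * received_energy n L N X p))) * indicator (space ?H) p \<partial>?H) =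
      ennreal (1 / energy_det n N X s) ^ L"
    unfolding mgf_received_energy(2)[OF assms, symmetric] by (intro nn_integral_cong) simp
  also have "ennreal (exp (- 1 * (s * T))) * ennreal (1 / energy_det n N X s) ^ L =
      ennreal (exp (- s * T - real L * ln (energy_det n N X s)))"
    using mgf_received_energy(1)[OF assms]
    by (simp add: ennreal_power exp_diff exp_of_nat_mult power_one_over flip: ennreal_mult')
  finally show ?thesis
    by (simp add: emeasure_eq_measure)
qed

lemma gram_eq_gram_kernel:
  assumes "\<And>k. k < N \<Longrightarrow> w k < M"
  shows "gram n M N cb w = kernel_mat n (gram_kernel N (\<lambda>i k. cb (w k) i))"
proof -
  have "(\<Sum>m<M. of_nat (card {k. k < N \<and> w k = m}) * f m) = (\<Sum>k<N. f (w k))" for f :: "nat \<Rightarrow> complex"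
  proof -
    have "(\<Sum>m<M. of_nat (card {k. k < N \<and> w k = m}) * f m) =
        (\<Sum>m<M. \<Sum>k\<in>{k \<in> {..<N}. w k = m}. f (w k))"
      by (intro sum.cong refl) simp
    also have "\<dots> = (\<Sum>k<N. f (w k))"
      by (rule sum.group) (use assms in auto)
    finally show ?thesis .
  qed
  from this[of "\<lambda>m. cb m i * cnj (cb m j)" for i j] show ?thesis
    by (simp add: gram_def gram_kernel_def mult.assoc)
qed

lemma lam1_eq_max_eigenvalue:
  "(\<And>k. k < N \<Longrightarrow> w k < M) \<Longrightarrow>
    lam1 n M N cb w = max_eigenvalue n (gram_kernel N (\<lambda>i k. cb (w k) i))"
  by (simp add: lam1_def max_eigenvalue_def gram_eq_gram_kernel)

lemma lam1_nonneg:
  assumes "n \<ge> 1" "\<And>k. k < N \<Longrightarrow> w k < M"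
  shows "0 \<le> lam1 n M N cb w"
  using assms by (simp add: lam1_eq_max_eigenvalue max_eigenvalue_gram_kernel_nonneg)

lemma chernoff_received_energy_Fmat:
  assumes "n \<ge> 1" "\<And>k. k < N \<Longrightarrow> w k < M" "s * (1 + lam1 n M N cb w) < 1"
  shows "measure (channel_measure n L N)
      {p \<in> space (channel_measure n L N). s * T \<le> s * received_energy n L N (\<lambda>i k. cb (w k) i) p}
    \<le> exp (- s * T - real L * ln (Re (det (1\<^sub>m n - complex_of_real s \<cdot>\<^sub>m Fmat n M N cb w))))"
  using assms chernoff_received_energy[of n s N "\<lambda>i k. cb (w k) i" L T]
  by (simp add: Fmat_def energy_det_def lam1_eq_max_eigenvalue gram_eq_gram_kernel)

lemma measure_received_energy_le_p1_integrand:
  assumes "n \<ge> 1" "\<And>k. k < N \<Longrightarrow> w k < M"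
  shows "measure (channel_measure n L N)
      {p \<in> space (channel_measure n L N).
        received_energy n L N (\<lambda>i k. cb (w k) i) p \<le> real n * real L * (1 + Kth * P')}
    \<le> p1_integrand n L M N P' Kth cb w"
    (is "measure ?H {p \<in> _. ?y p \<le> ?T} \<le> _")
  unfolding p1_integrand_def
proof (rule cINF_greatest)
  interpret prob_space ?H
    by (rule prob_space_channel_measure)
  fix \<rho> :: real assume "\<rho> \<in> {0..}"
  have "measure ?H {p \<in> space ?H. ?y p \<le> ?T} \<le> measure ?H {p \<in> space ?H. - \<rho> * ?T \<le> - \<rho> * ?y p}"
    using \<open>\<rho> \<in> {0..}\<close> by (intro finite_measure_mono) (auto intro: mult_left_mono)
  also have "\<dots> \<le> exp (- (- \<rho>) * ?T
      - real L * ln (Re (det (1\<^sub>m n - complex_of_real (- \<rho>) \<cdot>\<^sub>m Fmat n M N cb w))))"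
  proof (intro chernoff_received_energy_Fmat assms)
    have "0 \<le> \<rho> * (1 + lam1 n M N cb w)"
      using \<open>\<rho> \<in> {0..}\<close> lam1_nonneg[OF assms] by simp
    then show "- \<rho> * (1 + lam1 n M N cb w) < 1"
      by simp
  qed
  also have "1\<^sub>m n - complex_of_real (- \<rho>) \<cdot>\<^sub>m Fmat n M N cb w =
      1\<^sub>m n + complex_of_real \<rho> \<cdot>\<^sub>m Fmat n M N cb w"
    by (intro eq_matI) (auto simp: Fmat_def gram_def)
  finally show "measure ?H {p \<in> space ?H. ?y p \<le> ?T} \<le> exp (\<rho> * real n * real L * (1 + Kth * P')
      - real L * ln (Re (det (1\<^sub>m n + complex_of_real \<rho> \<cdot>\<^sub>m Fmat n M N cb w))))"
    by (simp add: mult.assoc)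
qed simp

lemma measure_received_energy_le_p2_integrand:
  assumes "n \<ge> 1" "\<And>k. k < N \<Longrightarrow> w k < M"
  shows "measure (channel_measure n L N)
      {p \<in> space (channel_measure n L N).
        real n * real L * (1 + Kth * P') \<le> received_energy n L N (\<lambda>i k. cb (w k) i) p}
    \<le> p2_integrand n L M N P' Kth cb w"
    (is "measure ?H {p \<in> _. ?T \<le> ?y p} \<le> _")
  unfolding p2_integrand_def
proof (rule cINF_greatest)
  interpret prob_space ?H
    by (rule prob_space_channel_measure)
  let ?max = "lam1 n M N cb w"
  have "0 \<le> ?max"
    by (rule lam1_nonneg[OF assms])
  then show "{0..<1 / (1 + ?max)} \<noteq> {}"
    by simp
  fix \<rho> :: real assume \<rho>: "\<rho> \<in> {0..<1 / (1 + ?max)}"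
  have "measure ?H {p \<in> space ?H. ?T \<le> ?y p} \<le> measure ?H {p \<in> space ?H. \<rho> * ?T \<le> \<rho> * ?y p}"
    using \<rho> by (intro finite_measure_mono) (auto intro: mult_left_mono)
  also have "\<dots> \<le> exp (- \<rho> * ?T
      - real L * ln (Re (det (1\<^sub>m n - complex_of_real \<rho> \<cdot>\<^sub>m Fmat n M N cb w))))"
    using \<rho> \<open>0 \<le> ?max\<close>
    by (intro chernoff_received_energy_Fmat assms) (simp_all add: pos_less_divide_eq)
  finally show "measure ?H {p \<in> space ?H. ?T \<le> ?y p} \<le> exp (- \<rho> * real n * real L * (1 + Kth * P')
      - real L * ln (Re (det (1\<^sub>m n - complex_of_real \<rho> \<cdot>\<^sub>m Fmat n M N cb w))))"
    by (simp add: mult.assoc)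
qed

section \<open>Norms of random codewords\<close>

lemma measure_eqI_atMost:
  fixes M N :: "real measure"
  assumes "sets M = sets borel" "sets N = sets borel"
    and "\<And>a. emeasure M {..a} \<noteq> \<infinity>" "\<And>a. emeasure M {..a} = emeasure N {..a}"
  shows "M = N"
proof (rule measure_eqI_generator_eq
    [where E = "range (\<lambda>a. {..a})" and \<Omega> = UNIV and A = "\<lambda>i. {..real i}"])
  show "Int_stable (range (\<lambda>a::real. {..a}))"
    by (auto simp: Int_stable_def)
  show "(\<Union>i. {..real i}) = UNIV"
    using real_arch_simple by auto
qed (use assms in \<open>auto simp: borel_eq_atMost\<close>)

lemma distr_lborel_norm_square:
  assumes "DIM('a::euclidean_space) = 2" "v > 0"
  shows "distr (lborel :: 'a measure) borel (\<lambda>z. (norm z)\<^sup>2 / v) =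
    density lborel (\<lambda>t. ennreal (pi * v) * indicator {0..} t)" (is "?M = ?N")
proof (rule measure_eqI_atMost)
  have distr_atMost: "emeasure ?M {..a} = ennreal (pi * v * max a 0)" for a
  proof -
    have "emeasure ?M {..a} = emeasure lborel {z :: 'a. (norm z)\<^sup>2 / v \<le> a}"
      by (subst emeasure_distr) (auto intro!: arg_cong[where f = "emeasure lborel"])
    also have "{z :: 'a. (norm z)\<^sup>2 / v \<le> a} = (if 0 \<le> a then cball 0 (sqrt (a * v)) else {})"
      using \<open>v > 0\<close> mult_neg_pos[of a v]
      by (auto simp: pos_divide_le_eq real_le_rsqrt sqrt_ge_absD dest: order_trans[OF zero_le_power2])
    also have "emeasure lborel \<dots> = ennreal (pi * v * max a 0)"
      using assms by (simp add: emeasure_cball unit_ball_vol_2 ac_simps)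
    finally show ?thesis .
  qed
  have density_atMost: "emeasure ?N {..a} = ennreal (pi * v * max a 0)" for a
  proof -
    have "emeasure ?N {..a} = (\<integral>\<^sup>+t. ennreal (pi * v) * indicator {0..a} t \<partial>lborel)"
      by (subst emeasure_density) (auto intro!: nn_integral_cong split: split_indicator)
    also have "\<dots> = ennreal (pi * v) * emeasure lborel {0..a}"
      by (rule nn_integral_cmult_indicator) simp
    also have "\<dots> = ennreal (pi * v * max a 0)"
      using \<open>v > 0\<close> by (cases "a \<ge> 0") (simp_all add: ennreal_mult'[symmetric])
    finally show ?thesis .
  qed
  show "emeasure ?M {..a} = emeasure ?N {..a}" "emeasure ?M {..a} \<noteq> \<infinity>" for a
    using distr_atMost density_atMost by simp_all
qed simp_all

lemma distributed_cgauss_norm_square: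
  assumes "v > 0"
  shows "distributed (cgauss v) lborel (\<lambda>z. (cmod z)\<^sup>2 / v) (exponential_density 1)"
proof -
  let ?f = "\<lambda>t. ennreal (exp (- t) / (pi * v))" and ?X = "\<lambda>z. (cmod z)\<^sup>2 / v"
  have "distr (cgauss v) lborel ?X = distr (density lborel (\<lambda>z. ?f (?X z))) borel ?X"
    unfolding cgauss_eq_density[OF assms] by (rule distr_cong) auto
  also have "\<dots> = density (distr lborel borel ?X) ?f"
    by (rule density_distr[symmetric]) auto
  also have "\<dots> = density lborel (\<lambda>t. ennreal (pi * v) * indicator {0..} t * ?f t)"
    using assms by (simp add: distr_lborel_norm_square density_density_eq)
  also have "(\<lambda>t. ennreal (pi * v) * indicator {0..} t * ?f t) = (\<lambda>t. ennreal (exponential_density 1 t))"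
    using assms
    by (auto simp: fun_eq_iff exponential_density_def ennreal_mult'[symmetric] split: split_indicator)
  finally show ?thesis
    by (simp add: distributed_def)
qed

lemma indep_vars_PiM_components:
  assumes "\<And>i. i \<in> I \<Longrightarrow> prob_space (M i)" "I \<noteq> {}"
  shows "prob_space.indep_vars (PiM I M) M (\<lambda>i x. x i) I"
proof -
  interpret prob_space "PiM I M"
    using assms by (intro prob_space_PiM)
  have "distr (PiM I M) (PiM I M) (\<lambda>x. \<lambda>i\<in>I. x i) = distr (PiM I M) (PiM I M) (\<lambda>x. x)"
    by (intro distr_cong) (auto simp: space_PiM PiE_def extensional_restrict)
  also have "\<dots> = PiM I (\<lambda>i. distr (PiM I M) (M i) (\<lambda>x. x i))"
    unfolding distr_id using assms by (intro PiM_cong refl) (simp add: distr_PiM_component)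
  finally show ?thesis
    using assms by (subst indep_vars_iff_distr_eq_PiM') auto
qed

lemma distributed_PiM_component:
  assumes "finite I" "\<And>i. i \<in> I \<Longrightarrow> prob_space (M i)" "i \<in> I" "distributed (M i) N X f"
  shows "distributed (PiM I M) N (\<lambda>x. X (x i)) f"
proof -
  have coord: "(\<lambda>x. x i) \<in> measurable (PiM I M) (M i)"
    using \<open>i \<in> I\<close> by (rule measurable_component_singleton)
  have X_measurable: "X \<in> measurable (M i) N"
    using assms(4) by (rule distributed_measurable)
  have "distr (PiM I M) N (\<lambda>x. X (x i)) = distr (distr (PiM I M) (M i) (\<lambda>x. x i)) N X"
    using coord X_measurable by (simp add: distr_distr comp_def)
  also have "distr (PiM I M) (M i) (\<lambda>x. x i) = M i"
    using assms by (intro distr_PiM_component) auto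
  finally show ?thesis
    using assms(4) measurable_compose[OF coord X_measurable] by (simp add: distributed_def)
qed

lemma distributed_PiM_cgauss_vsqnorm:
  assumes "n \<ge> 1" "v > 0"
  shows "distributed (PiM {..<n} (\<lambda>_. cgauss v)) lborel
    (\<lambda>x. vsqnorm n x / v) (erlang_density (n - 1) 1)"
proof -
  let ?M = "PiM {..<n} (\<lambda>_. cgauss v)" and ?X = "\<lambda>i x. (cmod (x i))\<^sup>2 / v"
  interpret prob_space ?M
    by (intro prob_space_PiM prob_space_cgauss assms(2))
  have nonempty: "{..<n} \<noteq> {}"
    using assms(1) by (simp add: lessThan_empty_iff)
  have "indep_vars (\<lambda>_. cgauss v) (\<lambda>i x. x i) {..<n}"
    using nonempty prob_space_cgauss[OF assms(2)] by (intro indep_vars_PiM_components)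
  then have "indep_vars (\<lambda>_. borel) ?X {..<n}"
    by (rule indep_vars_compose2) simp
  moreover have "distributed ?M lborel (?X i) (exponential_density 1)" if "i \<in> {..<n}" for i
    using that prob_space_cgauss[OF assms(2)] distributed_cgauss_norm_square[OF assms(2)]
    by (intro distributed_PiM_component[where X = "\<lambda>z. (cmod z)\<^sup>2 / v"]) simp_all
  ultimately have "distributed ?M lborel (\<lambda>x. \<Sum>i<n. ?X i x) (erlang_density (card {..<n} - 1) 1)"
    using nonempty by (intro exponential_distributed_sum) simp_all
  then show ?thesis
    by (simp add: vsqnorm_def sum_divide_distrib)
qed

lemma nn_integral_erlang_density_tail:
  assumes "n \<ge> 1" "a \<ge> 0"
  shows "(\<integral>\<^sup>+x. ennreal (erlang_density (n - 1) 1 x) * indicator {a..} x \<partial>lborel) =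
    ennreal (upper_gamma (real n) a / Gamma (real n))"
proof -
  let ?e = "\<lambda>x. erlang_density (n - 1) 1 x * indicator {a..} x"
  have Gamma: "Gamma (real n) = fact (n - 1)"
    using Gamma_fact[of "n - 1", where ?'a = real] assms by simp
  have "(\<integral>\<^sup>+x. ennreal (erlang_density (n - 1) 1 x) \<partial>lborel) = 1"
    using prob_space.emeasure_space_1[OF prob_space_erlang_density[of 1 "n - 1"]]
    by (simp add: emeasure_density)
  then have "integrable lborel (erlang_density (n - 1) 1)"
    by (intro integrableI_nonneg) auto
  then have "integrable lborel ?e"
    by (rule integrable_real_mult_indicator[rotated]) simp
  moreover have "upper_gamma (real n) a / Gamma (real n) = (LINT x|lborel. ?e x)"
  proof -
    have "AE x in lborel.
        indicat_real {a..} x *\<^sub>R (x powr (real n - 1) * exp (- x)) = fact (n - 1) * ?e x"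
      using AE_lborel_singleton[of 0]
    proof eventually_elim
      case (elim x)
      have "x powr (real n - 1) = x ^ (n - 1)" if "x > 0"
        using that assms by (simp add: powr_realpow[symmetric])
      then show ?case
        using elim assms by (auto simp: erlang_density_def split: split_indicator)
    qed
    then have "upper_gamma (real n) a = (LINT x|lborel. fact (n - 1) * ?e x)"
      unfolding upper_gamma_def set_lebesgue_integral_def by (intro integral_cong_AE) auto
    then show ?thesis
      by (simp add: Gamma)
  qed
  ultimately have "(\<integral>\<^sup>+x. ennreal (?e x) \<partial>lborel) = ennreal (upper_gamma (real n) a / Gamma (real n))"
    by (simp add: nn_integral_eq_integral)
  then show ?thesis
    by (simp add: ennreal_mult' ennreal_indicator)
qed

lemma emeasure_PiM_cgauss_vsqnorm_greater_le:
  assumes "n \<ge> 1" "v > 0" "r \<ge> 0"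
  shows "emeasure (PiM {..<n} (\<lambda>_. cgauss v)) {x \<in> space (PiM {..<n} (\<lambda>_. cgauss v)). r < vsqnorm n x}
    \<le> ennreal (upper_gamma (real n) (r / v) / Gamma (real n))"
proof -
  let ?M = "PiM {..<n} (\<lambda>_. cgauss v)" and ?X = "\<lambda>x. vsqnorm n x / v"
  have erlang: "distributed ?M lborel ?X (erlang_density (n - 1) 1)"
    using assms(1,2) by (rule distributed_PiM_cgauss_vsqnorm)
  have "emeasure ?M {x \<in> space ?M. r < vsqnorm n x} \<le> emeasure ?M (?X -` {r / v..} \<inter> space ?M)"
    using assms(2) distributed_measurable[OF erlang]
    by (intro emeasure_mono) (auto simp: measurable_sets divide_right_mono)
  also have "\<dots> = (\<integral>\<^sup>+x. ennreal (erlang_density (n - 1) 1 x) * indicator {r / v..} x \<partial>lborel)"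
    using distributed_emeasure[OF erlang, of "{r / v..}"] by simp
  also have "\<dots> = ennreal (upper_gamma (real n) (r / v) / Gamma (real n))"
    by (rule nn_integral_erlang_density_tail) (use assms in auto)
  finally show ?thesis .
qed

lemma borel_measurable_vsqnorm_PiM:
  "sets M = sets (PiM {..<n} (\<lambda>_. borel)) \<Longrightarrow> vsqnorm n \<in> borel_measurable M"
  using borel_measurable_vsqnorm[of n "\<lambda>x. x" "PiM {..<n} (\<lambda>_. borel)"]
  by (simp add: measurable_component_singleton cong: measurable_cong_sets)

lemma emeasure_lebC_polydisc:
  assumes "0 \<le> r"
  shows "emeasure (lebC n) (PiE {..<n} (\<lambda>_. cball 0 r)) = ennreal ((pi * r\<^sup>2) ^ n)"
proof -
  interpret product_sigma_finite "\<lambda>_. lborel :: complex measure" ..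
  show ?thesis
    using assms by (subst emeasure_PiM) (auto simp: emeasure_cball unit_ball_vol_2 ennreal_power)
qed

lemma emeasure_lebC_unit_ball:
  assumes "n \<ge> 1"
  shows "emeasure (lebC n) {x \<in> space (lebC n). vsqnorm n x \<le> 1} \<noteq> 0"
    and "emeasure (lebC n) {x \<in> space (lebC n). vsqnorm n x \<le> 1} \<noteq> \<infinity>"
proof -
  let ?B = "{x \<in> space (lebC n). vsqnorm n x \<le> 1}"
  have [measurable]: "vsqnorm n \<in> borel_measurable (lebC n)"
    by (intro borel_measurable_vsqnorm_PiM sets_PiM_cong) simp_all
  have ball_sets: "?B \<in> sets (lebC n)"
    by measurable
  have polydisc_sets: "PiE {..<n} (\<lambda>_. cball 0 r) \<in> sets (lebC n)" for r
    by (rule sets_PiM_I_finite) auto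
  have "cmod (x i) \<le> 1" if "vsqnorm n x \<le> 1" "i < n" for x i
    using norm_component_square_le_vsqnorm[OF that(2), of x] that(1) abs_square_le_1[of "cmod (x i)"]
    by simp
  then have "?B \<subseteq> PiE {..<n} (\<lambda>_. cball 0 1)"
    by (simp add: subset_iff space_PiM PiE_iff)
  then show "emeasure (lebC n) ?B \<noteq> \<infinity>"
    using emeasure_mono[OF _ polydisc_sets, of ?B 1] by (auto simp: emeasure_lebC_polydisc top_unique)
  have "PiE {..<n} (\<lambda>_. cball 0 (1 / sqrt n)) \<subseteq> ?B"
  proof
    fix x assume in_polydisc: "x \<in> PiE {..<n} (\<lambda>_. cball (0::complex) (1 / sqrt n))"
    have "(cmod (x i))\<^sup>2 \<le> 1 / real n" if "i < n" for i
      using power_mono[of "cmod (x i)" "1 / sqrt n" 2] in_polydisc that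
      by (auto simp: PiE_iff power_divide)
    then have "vsqnorm n x \<le> (\<Sum>i<n. 1 / real n)"
      unfolding vsqnorm_def by (intro sum_mono) auto
    then show "x \<in> ?B"
      using in_polydisc assms by (auto simp: space_PiM PiE_iff)
  qed
  then have "emeasure (lebC n) (PiE {..<n} (\<lambda>_. cball 0 (1 / sqrt n))) \<le> emeasure (lebC n) ?B"
    using ball_sets by (rule emeasure_mono)
  then have "ennreal ((pi * (1 / sqrt n)\<^sup>2) ^ n) \<le> emeasure (lebC n) ?B"
    by (simp add: emeasure_lebC_polydisc)
  moreover have "0 < ennreal ((pi * (1 / sqrt n)\<^sup>2) ^ n)"
    using assms by (simp add: power_divide)
  ultimately show "emeasure (lebC n) ?B \<noteq> 0"
    by force
qed

lemma measurable_radial_projection: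
  "(\<lambda>x. restrict (\<lambda>i. complex_of_real (r / sqrt (vsqnorm n x)) * x i) {..<n})
    \<in> measurable (lebC n) (PiM {..<n} (\<lambda>_. borel))"
proof -
  have [measurable]: "vsqnorm n \<in> borel_measurable (lebC n)"
    by (intro borel_measurable_vsqnorm_PiM sets_PiM_cong) simp_all
  show ?thesis
    by measurable
qed

lemma prob_space_sphere_unif:
  assumes "n \<ge> 1"
  shows "prob_space (sphere_unif n r)"
  unfolding sphere_unif_def
  by (intro prob_space.prob_space_distr prob_space_uniform_measure emeasure_lebC_unit_ball assms)
    (use measurable_radial_projection in simp)

lemma emeasure_sphere_unif_vsqnorm_greater_eq_0:
  "emeasure (sphere_unif n r) {x \<in> space (sphere_unif n r). r\<^sup>2 < vsqnorm n x} = 0"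
proof -
  let ?U = "uniform_measure (lebC n) {x \<in> space (lebC n). vsqnorm n x \<le> 1}"
  let ?f = "\<lambda>x. restrict (\<lambda>i. complex_of_real (r / sqrt (vsqnorm n x)) * x i) {..<n}"
  let ?T = "{x \<in> space (PiM {..<n} (\<lambda>_. borel)). r\<^sup>2 < vsqnorm n x}"
  have [measurable]: "vsqnorm n \<in> borel_measurable (PiM {..<n} (\<lambda>_. borel))"
    by (rule borel_measurable_vsqnorm_PiM) simp
  have outside_sets: "?T \<in> sets (PiM {..<n} (\<lambda>_. borel))"
    by measurable
  have projection: "?f \<in> measurable ?U (PiM {..<n} (\<lambda>_. borel))"
    using measurable_radial_projection by simp
  have "vsqnorm n (?f x) \<le> r\<^sup>2" for x
  proof -
    have "vsqnorm n (?f x) = vsqnorm n (\<lambda>i. complex_of_real (r / sqrt (vsqnorm n x)) * x i)"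
      by (rule vsqnorm_cong) simp
    also have "\<dots> = (r / sqrt (vsqnorm n x))\<^sup>2 * vsqnorm n x"
      unfolding vsqnorm_scale norm_of_real power2_abs ..
    also have "\<dots> \<le> r\<^sup>2"
      by (cases "vsqnorm n x = 0") (simp_all add: power_divide)
    finally show ?thesis .
  qed
  then have "?f -` ?T \<inter> space ?U = {}"
    by (auto simp: not_less[symmetric])
  then show ?thesis
    unfolding sphere_unif_def using emeasure_distr[OF projection outside_sets] by simp
qed

lemma sets_col_dist: "sets (col_dist sph n P P') = sets (PiM {..<n} (\<lambda>_. borel))"
  unfolding col_dist_def sphere_unif_def by (auto intro!: sets_PiM_cong)

lemma prob_space_col_dist:
  assumes "n \<ge> 1" "P' > 0"
  shows "prob_space (col_dist sph n P P')"
  unfolding col_dist_def using assms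
  by (auto intro: prob_space_sphere_unif prob_space_PiM prob_space_cgauss)

text \<open>\<^term>\<open>p0 sph n 1 P P'\<close> is the part of the union bound that belongs to one user.\<close>

lemma emeasure_col_dist_overpower_le:
  assumes "n \<ge> 1" "P > 0" "P' > 0"
  shows "emeasure (col_dist sph n P P') {x \<in> space (col_dist sph n P P'). real n * P < vsqnorm n x}
    \<le> ennreal (p0 sph n 1 P P')"
  using assms emeasure_sphere_unif_vsqnorm_greater_eq_0[of n "sqrt (real n * P)"]
    emeasure_PiM_cgauss_vsqnorm_greater_le[of n P' "real n * P"]
  by (simp add: col_dist_def p0_def)

section \<open>Union bound\<close>

lemma sets_random_coordinate:
  fixes J :: "'b \<Rightarrow> 'i"
  assumes "finite I" "J \<in> measurable N (count_space UNIV)" and [measurable]: "T \<in> sets D"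
  shows "{p \<in> space (PiM I (\<lambda>_. D) \<Otimes>\<^sub>M N). J (snd p) \<in> I \<longrightarrow> fst p (J (snd p)) \<in> T}
    \<in> sets (PiM I (\<lambda>_. D) \<Otimes>\<^sub>M N)"
proof -
  let ?M = "PiM I (\<lambda>_. D) \<Otimes>\<^sub>M N"
  have [measurable]: "(\<lambda>p. J (snd p)) \<in> measurable ?M (count_space UNIV)"
    using measurable_snd assms(2) by (rule measurable_compose)
  have "{p \<in> space ?M. J (snd p) \<in> I \<longrightarrow> fst p (J (snd p)) \<in> T} =
      {p \<in> space ?M. J (snd p) \<in> - I} \<union> (\<Union>i\<in>I. {p \<in> space ?M. J (snd p) = i \<and> fst p i \<in> T})"
    by auto
  also have "\<dots> \<in> sets ?M"
  proof (intro sets.Un sets.finite_UN \<open>finite I\<close>)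
    show "{p \<in> space ?M. J (snd p) \<in> - I} \<in> sets ?M"
      by (rule measurable_sets_Collect) measurable
    show "{p \<in> space ?M. J (snd p) = i \<and> fst p i \<in> T} \<in> sets ?M" if "i \<in> I" for i
      using that by measurable
  qed
  finally show ?thesis .
qed

lemma emeasure_random_coordinate:
  fixes J :: "'b \<Rightarrow> 'i"
  assumes "prob_space D" "prob_space N" "finite I" "J \<in> measurable N (count_space UNIV)"
    and "AE y in N. J y \<in> I" "T \<in> sets D"
  shows "emeasure (PiM I (\<lambda>_. D) \<Otimes>\<^sub>M N)
    {p \<in> space (PiM I (\<lambda>_. D) \<Otimes>\<^sub>M N). J (snd p) \<in> I \<longrightarrow> fst p (J (snd p)) \<in> T} = emeasure D T"
    (is "emeasure ?M ?E = _")
proof -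
  interpret D: product_prob_space "\<lambda>_. D" I
    by (intro product_prob_spaceI assms)
  interpret N: prob_space N
    by fact
  interpret pair_prob_space "PiM I (\<lambda>_. D)" N ..
  have "emeasure ?M ?E = (\<integral>\<^sup>+y. emeasure (PiM I (\<lambda>_. D)) ((\<lambda>x. (x, y)) -` ?E) \<partial>N)"
    by (intro emeasure_pair_measure_alt2 sets_random_coordinate assms)
  also have "\<dots> = (\<integral>\<^sup>+y. emeasure D T \<partial>N)"
  proof (rule nn_integral_cong_AE)
    show "AE y in N. emeasure (PiM I (\<lambda>_. D)) ((\<lambda>x. (x, y)) -` ?E) = emeasure D T"
      using \<open>AE y in N. J y \<in> I\<close> AE_space
    proof eventually_elim
      case (elim y)
      then have "(\<lambda>x. (x, y)) -` ?E = {x \<in> space (PiM I (\<lambda>_. D)). x (J y) \<in> T}"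
        by (auto simp: space_pair_measure)
      then show ?case
        using elim \<open>T \<in> sets D\<close> by (simp add: D.emeasure_PiM_Collect_single)
    qed
  qed
  finally show ?thesis
    by (simp add: N.emeasure_space_1)
qed

lemma borel_measurable_emeasure_slice:
  assumes "sigma_finite_measure C" and E_sets: "E \<in> sets (A \<Otimes>\<^sub>M (B \<Otimes>\<^sub>M C))"
  shows "(\<lambda>q. emeasure C {z. (fst q, snd q, z) \<in> E}) \<in> borel_measurable (A \<Otimes>\<^sub>M B)"
proof -
  interpret C: sigma_finite_measure C by fact
  let ?E = "(\<lambda>(q, z). (fst q, snd q, z)) -` E \<inter> space ((A \<Otimes>\<^sub>M B) \<Otimes>\<^sub>M C)"
  have "?E \<in> sets ((A \<Otimes>\<^sub>M B) \<Otimes>\<^sub>M C)"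
    by (rule measurable_sets[OF _ E_sets]) measurable
  then have "(\<lambda>q. emeasure C (Pair q -` ?E)) \<in> borel_measurable (A \<Otimes>\<^sub>M B)"
    by (rule C.measurable_emeasure_Pair)
  moreover have "Pair q -` ?E = {z. (fst q, snd q, z) \<in> E}" if "q \<in> space (A \<Otimes>\<^sub>M B)" for q
    using that sets.sets_into_space[OF E_sets] by (auto simp: space_pair_measure)
  ultimately show ?thesis
    by (simp cong: measurable_cong)
qed

lemma emeasure_pair_measure_assoc:
  assumes "sigma_finite_measure B" "sigma_finite_measure C" and E_sets: "E \<in> sets (A \<Otimes>\<^sub>M (B \<Otimes>\<^sub>M C))"
  shows "emeasure (A \<Otimes>\<^sub>M (B \<Otimes>\<^sub>M C)) E = (\<integral>\<^sup>+q. emeasure C {z. (fst q, snd q, z) \<in> E} \<partial>(A \<Otimes>\<^sub>M B))"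
proof -
  interpret B: sigma_finite_measure B by fact
  interpret C: sigma_finite_measure C by fact
  interpret BC: sigma_finite_measure "B \<Otimes>\<^sub>M C"
    by (intro sigma_finite_pair_measure assms)
  have "emeasure (A \<Otimes>\<^sub>M (B \<Otimes>\<^sub>M C)) E = (\<integral>\<^sup>+x. emeasure (B \<Otimes>\<^sub>M C) (Pair x -` E) \<partial>A)"
    using E_sets by (rule BC.emeasure_pair_measure_alt)
  also have "\<dots> = (\<integral>\<^sup>+x. \<integral>\<^sup>+y. emeasure C {z. (x, y, z) \<in> E} \<partial>B \<partial>A)"
    using sets_Pair1[OF E_sets]
    by (intro nn_integral_cong) (simp add: C.emeasure_pair_measure_alt vimage_def)
  also have "\<dots> = (\<integral>\<^sup>+q. emeasure C {z. (fst q, snd q, z) \<in> E} \<partial>(A \<Otimes>\<^sub>M B))"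
    using B.nn_integral_fst[OF borel_measurable_emeasure_slice[OF assms(2) E_sets]] by simp
  finally show ?thesis .
qed

text \<open>The bound \<open>f\<close> need not be measurable, so its integral is only a lower integral and cannot be
  split; the measurable function \<open>g\<close> is split instead.\<close>

lemma nn_integral_le_nn_integral_plus_emeasure:
  assumes "g \<in> borel_measurable M" "B \<in> sets M" "\<And>x. x \<in> space M \<Longrightarrow> g x \<le> 1"
    and "\<And>x. x \<in> space M - B \<Longrightarrow> g x \<le> f x"
  shows "(\<integral>\<^sup>+x. g x \<partial>M) \<le> (\<integral>\<^sup>+x. f x \<partial>M) + emeasure M B"
proof -
  note assms(1,2) [measurable]
  have "(\<integral>\<^sup>+x. g x \<partial>M) = (\<integral>\<^sup>+x. g x * indicator (space M - B) x + g x * indicator B x \<partial>M)"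
    by (intro nn_integral_cong) (auto split: split_indicator)
  also have "\<dots> = (\<integral>\<^sup>+x. g x * indicator (space M - B) x \<partial>M) + (\<integral>\<^sup>+x. g x * indicator B x \<partial>M)"
    by (rule nn_integral_add) measurable
  also have "\<dots> \<le> (\<integral>\<^sup>+x. f x \<partial>M) + (\<integral>\<^sup>+x. indicator B x \<partial>M)"
    using assms(3,4) by (intro add_mono nn_integral_mono) (auto split: split_indicator)
  finally show ?thesis
    by simp
qed

lemma prob_space_msg_measure: "prob_space (msg_measure Ka M)"
  unfolding msg_measure_def by (intro prob_space_PiM prob_space_measure_pmf)

lemma measurable_msg_component:
  assumes "k < Ka"
  shows "(\<lambda>w. w k) \<in> measurable (msg_measure Ka M) (count_space UNIV)"
proof -
  have "(\<lambda>w. w k) \<in> measurable (msg_measure Ka M) (measure_pmf (pmf_of_set {..<M}))"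
    unfolding msg_measure_def using assms by (intro measurable_component_singleton) simp
  then show ?thesis
    by simp
qed

lemma AE_msg_component:
  assumes "M \<ge> 1" "k < Ka"
  shows "AE w in msg_measure Ka M. w k \<in> {..<M}"
proof -
  have "AE m in measure_pmf (pmf_of_set {..<M}). m \<in> {..<M}"
    using assms(1) by (auto simp: AE_measure_pmf_iff lessThan_empty_iff)
  then show ?thesis
    unfolding msg_measure_def using assms(2) by (intro AE_PiM_component prob_space_measure_pmf) auto
qed

text \<open>Messages outside \<open>{..<M}\<close> have probability zero but do lie in the sample space; the event
  includes them.\<close>

definition overpower_event ::
    "bool \<Rightarrow> nat \<Rightarrow> nat \<Rightarrow> real \<Rightarrow> real \<Rightarrow> nat \<Rightarrow> nat \<Rightarrow> ((nat \<Rightarrow> nat \<Rightarrow> complex) \<times> (nat \<Rightarrow> nat)) set" where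
  "overpower_event sph n M P P' Ka k =
    {(cb, w) \<in> space (codebook_measure sph n M P P' \<Otimes>\<^sub>M msg_measure Ka M).
      w k < M \<longrightarrow> real n * P < vsqnorm n (cb (w k))}"

lemma
  assumes "n \<ge> 1" "M \<ge> 1" "P > 0" "P' > 0" "k < Ka"
  shows sets_overpower_event: "overpower_event sph n M P P' Ka k \<in>
      sets (codebook_measure sph n M P P' \<Otimes>\<^sub>M msg_measure Ka M)"
    and emeasure_overpower_event_le: "emeasure (codebook_measure sph n M P P' \<Otimes>\<^sub>M msg_measure Ka M)
      (overpower_event sph n M P P' Ka k) \<le> ennreal (p0 sph n 1 P P')"
proof -
  let ?C = "codebook_measure sph n M P P'" and ?D = "col_dist sph n P P'"
  let ?T = "{x \<in> space ?D. real n * P < vsqnorm n x}"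
  have [measurable]: "vsqnorm n \<in> borel_measurable ?D"
    by (intro borel_measurable_vsqnorm_PiM sets_col_dist)
  have T_sets: "?T \<in> sets ?D"
    by measurable
  have "cb m \<in> space ?D" if "cb \<in> space ?C" "m < M" for cb m
    using that by (simp add: codebook_measure_def space_PiM PiE_iff)
  then have event_eq: "overpower_event sph n M P P' Ka k =
      {p \<in> space (?C \<Otimes>\<^sub>M msg_measure Ka M). snd p k \<in> {..<M} \<longrightarrow> fst p (snd p k) \<in> ?T}"
    by (fastforce simp: overpower_event_def space_pair_measure)
  show "overpower_event sph n M P P' Ka k \<in> sets (?C \<Otimes>\<^sub>M msg_measure Ka M)"
    unfolding event_eq codebook_measure_def
    by (intro sets_random_coordinate measurable_msg_component assms T_sets) simp
  have "emeasure (?C \<Otimes>\<^sub>M msg_measure Ka M) (overpower_event sph n M P P' Ka k) = emeasure ?D ?T"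
    unfolding event_eq codebook_measure_def
    by (intro emeasure_random_coordinate prob_space_col_dist prob_space_msg_measure
        measurable_msg_component AE_msg_component assms T_sets) simp
  also have "\<dots> \<le> ennreal (p0 sph n 1 P P')"
    by (intro emeasure_col_dist_overpower_le assms)
  finally show "emeasure (?C \<Otimes>\<^sub>M msg_measure Ka M) (overpower_event sph n M P P' Ka k)
    \<le> ennreal (p0 sph n 1 P P')" .
qed

lemma emeasure_UN_overpower_event_le:
  assumes "n \<ge> 1" "M \<ge> 1" "P > 0" "P' > 0"
  shows "emeasure (codebook_measure sph n M P P' \<Otimes>\<^sub>M msg_measure Ka M)
    (\<Union>k<Ka. overpower_event sph n M P P' Ka k) \<le> ennreal (p0 sph n Ka P P')"
proof -
  let ?M = "codebook_measure sph n M P P' \<Otimes>\<^sub>M msg_measure Ka M"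
  have "emeasure ?M (\<Union>k<Ka. overpower_event sph n M P P' Ka k) \<le>
      (\<Sum>k<Ka. emeasure ?M (overpower_event sph n M P P' Ka k))"
    using sets_overpower_event[OF assms] by (intro emeasure_subadditive_finite) auto
  also have "\<dots> \<le> (\<Sum>k<Ka. ennreal (p0 sph n 1 P P'))"
    using emeasure_overpower_event_le[OF assms] by (intro sum_mono) auto
  also have "\<dots> = ennreal (p0 sph n Ka P P')"
    by (simp add: p0_def ennreal_of_nat_eq_real_of_nat flip: ennreal_mult')
  finally show ?thesis .
qed

lemma emeasure_scheme_space_le:
  fixes bnd :: "(nat \<Rightarrow> nat \<Rightarrow> complex) \<Rightarrow> (nat \<Rightarrow> nat) \<Rightarrow> ennreal"
  assumes "n \<ge> 1" "M \<ge> 1" "P > 0" "P' > 0"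
    and slice: "\<And>cb w. (\<And>k. k < Ka \<Longrightarrow> w k < M) \<Longrightarrow>
      (\<And>k. k < Ka \<Longrightarrow> vsqnorm n (cb (w k)) \<le> real n * P) \<Longrightarrow>
      emeasure (channel_measure n L Ka) {p. (cb, w, p) \<in> E} \<le> bnd cb w"
  shows "emeasure (scheme_space sph n L M P P' Ka) E \<le>
    (\<integral>\<^sup>+(cb,w). bnd cb w \<partial>(codebook_measure sph n M P P' \<Otimes>\<^sub>M msg_measure Ka M))
      + ennreal (p0 sph n Ka P P')"
proof (cases "E \<in> sets (scheme_space sph n L M P P' Ka)")
  case False
  then show ?thesis
    by (simp add: emeasure_notin_sets)
next
  case True
  let ?C = "codebook_measure sph n M P P'" and ?W = "msg_measure Ka M" and ?H = "channel_measure n L Ka"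
  let ?B = "\<Union>k<Ka. overpower_event sph n M P P' Ka k"
  interpret W: prob_space ?W
    by (rule prob_space_msg_measure)
  interpret H: prob_space ?H
    by (rule prob_space_channel_measure)
  have scheme: "scheme_space sph n L M P P' Ka = ?C \<Otimes>\<^sub>M (?W \<Otimes>\<^sub>M ?H)"
    by (simp add: scheme_space_def channel_measure_def)
  have E_sets: "E \<in> sets (?C \<Otimes>\<^sub>M (?W \<Otimes>\<^sub>M ?H))"
    using True by (simp add: scheme)
  have "emeasure (scheme_space sph n L M P P' Ka) E =
      (\<integral>\<^sup>+q. emeasure ?H {p. (fst q, snd q, p) \<in> E} \<partial>(?C \<Otimes>\<^sub>M ?W))"
    unfolding scheme
    by (intro emeasure_pair_measure_assoc W.sigma_finite_measure_axioms
        H.sigma_finite_measure_axioms E_sets)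
  also have "\<dots> \<le> (\<integral>\<^sup>+q. bnd (fst q) (snd q) \<partial>(?C \<Otimes>\<^sub>M ?W)) + emeasure (?C \<Otimes>\<^sub>M ?W) ?B"
  proof (rule nn_integral_le_nn_integral_plus_emeasure)
    show "(\<lambda>q. emeasure ?H {p. (fst q, snd q, p) \<in> E}) \<in> borel_measurable (?C \<Otimes>\<^sub>M ?W)"
      by (intro borel_measurable_emeasure_slice H.sigma_finite_measure_axioms E_sets)
    show "?B \<in> sets (?C \<Otimes>\<^sub>M ?W)"
      using sets_overpower_event[OF assms(1-4)] by auto
    show "emeasure ?H {p. (fst q, snd q, p) \<in> E} \<le> bnd (fst q) (snd q)"
      if "q \<in> space (?C \<Otimes>\<^sub>M ?W) - ?B" for q
      using that by (intro slice) (force simp: overpower_event_def)+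
  qed (rule H.emeasure_le_1)
  also have "emeasure (?C \<Otimes>\<^sub>M ?W) ?B \<le> ennreal (p0 sph n Ka P P')"
    by (rule emeasure_UN_overpower_event_le[OF assms(1-4)])
  finally show ?thesis
    by (simp add: case_prod_unfold add_left_mono)
qed

section \<open>Estimating the number of active users\<close>

lemma is_est_midpoint:
  assumes "is_est n L K P' y Kest" "Kt \<le> K" "n \<ge> 1" "L \<ge> 1" "P' > 0"
  shows "Kest < Kt \<Longrightarrow> y \<le> real n * real L * (1 + (real Kest + real Kt) / 2 * P')"
    and "Kt < Kest \<Longrightarrow> real n * real L * (1 + (real Kest + real Kt) / 2 * P') \<le> y"
proof -
  define mean where "mean k = real n * real L * (1 + real k * P')" for k :: nat
  have closer: "\<bar>y - mean Kest\<bar> \<le> \<bar>y - mean Kt\<bar>"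
    using assms(1,2) by (simp add: is_est_def mean_def)
  have midpoint: "real n * real L * (1 + (real Kest + real Kt) / 2 * P') = (mean Kest + mean Kt) / 2"
    by (simp add: mean_def field_simps)
  have mean_less: "mean k < mean k'" if "k < k'" for k k'
    using assms(3-5) that by (simp add: mean_def)
  show "y \<le> real n * real L * (1 + (real Kest + real Kt) / 2 * P')" if "Kest < Kt"
    using closer mean_less[OF that] unfolding midpoint by (auto simp: abs_if split: if_splits)
  show "real n * real L * (1 + (real Kest + real Kt) / 2 * P') \<le> y" if "Kt < Kest"
    using closer mean_less[OF that] unfolding midpoint by (auto simp: abs_if split: if_splits)
qed

lemma frob2_rx_eq_received_energy:
  assumes "\<And>k. k < Ka \<Longrightarrow> vsqnorm n (cb (w k)) \<le> real n * P"
  shows "frob2 n L (rx n P Ka cb w h z) = received_energy n L Ka (\<lambda>i k. cb (w k) i) (h, z)"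
  using assms
  by (simp add: frob2_def rx_def received_energy_def vsqnorm_def kernel_mult_def xmit_def mult.commute)

lemma emeasure_est_event_le:
  assumes "n \<ge> 1" "M \<ge> 1" "P > 0" "P' > 0"
    and slice: "\<And>cb w. (\<And>k. k < Ka \<Longrightarrow> w k < M) \<Longrightarrow>
      measure (channel_measure n L Ka) {p \<in> space (channel_measure n L Ka).
        is_est n L K P' (received_energy n L Ka (\<lambda>i k. cb (w k) i) p) Kest} \<le> bnd cb w"
  shows "emeasure (scheme_space sph n L M P P' Ka) (est_event sph n L M K P P' Ka Kest) \<le>
    (\<integral>\<^sup>+(cb,w). ennreal (bnd cb w) \<partial>(codebook_measure sph n M P P' \<Otimes>\<^sub>M msg_measure Ka M))
      + ennreal (p0 sph n Ka P P')"
proof (rule emeasure_scheme_space_le[OF assms(1-4)])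
  fix cb w
  assume messages: "\<And>k. k < Ka \<Longrightarrow> w k < M"
    and power: "\<And>k. k < Ka \<Longrightarrow> vsqnorm n (cb (w k)) \<le> real n * P"
  let ?H = "channel_measure n L Ka" and ?E = "{p. (cb, w, p) \<in> est_event sph n L M K P P' Ka Kest}"
  let ?A = "{p \<in> space ?H. is_est n L K P' (received_energy n L Ka (\<lambda>i k. cb (w k) i) p) Kest}"
  interpret prob_space ?H
    by (rule prob_space_channel_measure)
  have "?E \<subseteq> ?A"
    using frob2_rx_eq_received_energy[of Ka n cb w P, OF power]
    by (auto simp: est_event_def scheme_space_def channel_measure_def space_pair_measure)
  moreover have "?A \<in> sets ?H"
    unfolding is_est_def by measurable
  ultimately have "emeasure ?H ?E \<le> emeasure ?H ?A"
    by (rule emeasure_mono)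
  also have "\<dots> \<le> ennreal (bnd cb w)"
    unfolding emeasure_eq_measure using slice[of w, OF messages] by (rule ennreal_leI)
  finally show "emeasure ?H ?E \<le> ennreal (bnd cb w)" .
qed

lemma emeasure_est_event_le_p1:
  assumes "n \<ge> 1" "L \<ge> 1" "M \<ge> 1" "P > 0" "P' > 0" "Kt \<le> K" "Kest < Kt"
  shows "emeasure (scheme_space sph n L M P P' Ka) (est_event sph n L M K P P' Ka Kest)
    \<le> p1 sph n L M Ka P P' ((real Kest + real Kt) / 2) + ennreal (p0 sph n Ka P P')"
  unfolding p1_def
proof (rule emeasure_est_event_le)
  fix cb w
  assume "\<And>k. k < Ka \<Longrightarrow> w k < M"
  let ?H = "channel_measure n L Ka" and ?y = "received_energy n L Ka (\<lambda>i k. cb (w k) i)"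
  let ?T = "real n * real L * (1 + (real Kest + real Kt) / 2 * P')"
  interpret prob_space ?H
    by (rule prob_space_channel_measure)
  have "measure ?H {p \<in> space ?H. is_est n L K P' (?y p) Kest} \<le> measure ?H {p \<in> space ?H. ?y p \<le> ?T}"
    using is_est_midpoint(1)[OF _ assms(6,1,2,5,7)]
    by (intro finite_measure_mono) (blast, measurable)
  also have "\<dots> \<le> p1_integrand n L M Ka P' ((real Kest + real Kt) / 2) cb w"
    by (rule measure_received_energy_le_p1_integrand) fact+
  finally show "measure ?H {p \<in> space ?H. is_est n L K P' (?y p) Kest}
    \<le> p1_integrand n L M Ka P' ((real Kest + real Kt) / 2) cb w" .
qed (fact assms)+

lemma emeasure_est_event_le_p2:
  assumes "n \<ge> 1" "L \<ge> 1" "M \<ge> 1" "P > 0" "P' > 0" "Kt \<le> K" "Kt < Kest"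
  shows "emeasure (scheme_space sph n L M P P' Ka) (est_event sph n L M K P P' Ka Kest)
    \<le> p2 sph n L M Ka P P' ((real Kest + real Kt) / 2) + ennreal (p0 sph n Ka P P')"
  unfolding p2_def
proof (rule emeasure_est_event_le)
  fix cb w
  assume "\<And>k. k < Ka \<Longrightarrow> w k < M"
  let ?H = "channel_measure n L Ka" and ?y = "received_energy n L Ka (\<lambda>i k. cb (w k) i)"
  let ?T = "real n * real L * (1 + (real Kest + real Kt) / 2 * P')"
  interpret prob_space ?H
    by (rule prob_space_channel_measure)
  have "measure ?H {p \<in> space ?H. is_est n L K P' (?y p) Kest} \<le> measure ?H {p \<in> space ?H. ?T \<le> ?y p}"
    using is_est_midpoint(2)[OF _ assms(6,1,2,5,7)]
    by (intro finite_measure_mono) (blast, measurable)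
  also have "\<dots> \<le> p2_integrand n L M Ka P' ((real Kest + real Kt) / 2) cb w"
    by (rule measure_received_energy_le_p2_integrand) fact+
  finally show "measure ?H {p \<in> space ?H. is_est n L K P' (?y p) Kest}
    \<le> p2_integrand n L M Ka P' ((real Kest + real Kt) / 2) cb w" .
qed (fact assms)+

lemma p_new_cases:
  assumes "K \<ge> 1"
  obtains (p1) Kt where "Kt \<le> K" "Kest < Kt"
      "p_new sph n L M K Ka P P' Kest = p1 sph n L M Ka P P' ((real Kest + real Kt) / 2)"
    | (p2) Kt where "Kt \<le> K" "Kt < Kest"
      "p_new sph n L M K Ka P P' Kest = p2 sph n L M Ka P P' ((real Kest + real Kt) / 2)"
proof -
  let ?bound = "\<lambda>Kt. (if Kest < Kt then p1 sph n L M Ka P P' ((real Kest + real Kt) / 2) else 0)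
    + (if Kest > Kt then p2 sph n L M Ka P P' ((real Kest + real Kt) / 2) else 0)"
  have "(if Kest = 0 then 1 else 0) \<in> {0..K} - {Kest}"
    using assms by auto
  then have "{0..K} - {Kest} \<noteq> {}"
    by blast
  then have "p_new sph n L M K Ka P P' Kest \<in> ?bound ` ({0..K} - {Kest})"
    unfolding p_new_def by (intro Min_in) auto
  then obtain Kt where "p_new sph n L M K Ka P P' Kest = ?bound Kt" "Kt \<in> {0..K} - {Kest}"
    by (rule imageE)
  then show ?thesis
    using that by (cases "Kest < Kt") auto
qed

theorem theorem1:
  fixes n L M K Ka Kest :: nat and P P' :: real and sph :: bool
  assumes "n \<ge> 1" "L \<ge> 1" "M \<ge> 1" "K \<ge> 1"
    and "P > 0" and "Ka \<le> K"
    and "0 < P'" "P' \<le> P" "sph \<Longrightarrow> P' = P"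
    and "Kest \<le> K" "Kest \<noteq> Ka"
  shows "emeasure (scheme_space sph n L M P P' Ka) (est_event sph n L M K P P' Ka Kest)
           \<le> p_new sph n L M K Ka P P' Kest + ennreal (p0 sph n Ka P P')"
  using \<open>K \<ge> 1\<close>
proof (cases rule: p_new_cases[of K Kest sph n L M Ka P P'])
  case (p1 Kt)
  show ?thesis
    unfolding p1(3) by (rule emeasure_est_event_le_p1) fact+
next
  case (p2 Kt)
  show ?thesis
    unfolding p2(3) by (rule emeasure_est_event_le_p2) fact+
qed

end
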